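(* For every knot $K\subset S^3$ and every integer $n\in\mathbb{N}$ there exists an embedding $Q:S^3\hookrightarrow\mathbb{C}^3$ of class $\mathcal{C}^n$ such that the set of complex tangents to $Q(S^3)$ is precisely a knot which is equivalent (up to homeomorphism) to $K$; i.e. every topological knot type in $S^3$ may arise precisely as the set of complex tangents to some embedding into $\mathbb{C}^3$. Furthermore, the embedding can be taken to be $\mathcal{C}^\infty$ away from a certain (degenerate) point.
   Context: $S^3=\{(z,w)\in\mathbb{C}^2 : |z|^2+|w|^2=1\}$, and $\mathbb{N}$ denotes the positive integers. A knot in $S^3$ is a smooth (at least continuous) simple embedding of the circle $S^1$ into $S^3$ (no double points), identified with its image. Two smooth (continuous) knots $K_1,K_2\subset S^3$ are topologically equivalent, or of the same topological type, if there is a diffeomorphism (homeomorphism) $h:S^3\to S^3$ with $h(K_1)=K_2$; in the claim, equivalence is up to homeomorphism. Complex tangents: for a real $3$-manifold $M$ that is $\mathcal{C}^1$-embedded in $\mathbb{C}^3$, let $J$ denote multiplication by $i$ on each tangent space of $\mathbb{C}^3$. A point $x\in M$ is complex tangent if $T_xM\cap J(T_xM)\neq\{0\}$, i.e. if $T_xM$ contains a complex line. The set of complex tangents of $Q(S^3)$ is regarded as a subset of $S^3$ via $Q$. Degenerate point: the embeddings in question are graphs $(z,w)\mapsto(z,w,q(z,w))$ over $S^3$ of a function $q$; the exceptional point is a complex tangent and is called degenerate because all of the derivatives that are defined at the point (those of $q$) are zero there. *)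

theory Defs
  imports "HOL-Analysis.Analysis" "HOL-Library.Extended_Nat"
begin

definition S3 :: "(complex \<times> complex) set" where
  "S3 = {(z, w). (cmod z)\<^sup>2 + (cmod w)\<^sup>2 = 1}"

text \<open>Iterated directional derivative; the head of the list is the direction of the last
  differentiation.\<close>

primrec iter_deriv ::
  "'a::real_normed_vector list \<Rightarrow> ('a \<Rightarrow> 'b::real_normed_vector) \<Rightarrow> 'a \<Rightarrow> 'b" where
  "iter_deriv [] f = f"
| "iter_deriv (v # vs) f = (\<lambda>x. frechet_derivative (iter_deriv vs f) (at x) v)"

text \<open>Only meant for open \<open>U\<close>.\<close>

definition Ck_on ::
  "enat \<Rightarrow> 'a::real_normed_vector set \<Rightarrow> ('a \<Rightarrow> 'b::real_normed_vector) \<Rightarrow> bool" where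
  "Ck_on k U f \<longleftrightarrow>
     (\<forall>vs. enat (length vs) < k \<longrightarrow> (\<forall>x\<in>U. iter_deriv vs f differentiable (at x))) \<and>
     (\<forall>vs. enat (length vs) \<le> k \<longrightarrow> continuous_on U (iter_deriv vs f))"

definition Ck_extension ::
  "enat \<Rightarrow> 'a::real_normed_vector set \<Rightarrow> ('a \<Rightarrow> 'b::real_normed_vector) \<Rightarrow> 'a \<Rightarrow> ('a \<Rightarrow> 'b) \<Rightarrow> bool"
  where
  "Ck_extension k M f x g \<longleftrightarrow>
     (\<exists>U. open U \<and> x \<in> U \<and> Ck_on k U g \<and> (\<forall>y\<in>U \<inter> M. g y = f y))"

text \<open>For an embedded submanifold \<open>M\<close> (such as \<open>S3\<close> or \<open>S3\<close> minus a point), a function on \<open>M\<close>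
  is of class C^k in charts iff it extends locally to C^k functions on the ambient space.\<close>

definition Ck_map ::
  "enat \<Rightarrow> 'a::real_normed_vector set \<Rightarrow> ('a \<Rightarrow> 'b::real_normed_vector) \<Rightarrow> bool" where
  "Ck_map k M f \<longleftrightarrow> (\<forall>x\<in>M. \<exists>g. Ck_extension k M f x g)"

text \<open>Velocities of C^1 curves in \<open>M\<close>; this is the tangent space when \<open>M\<close> is a
  C^1 submanifold.\<close>

definition tangent_space :: "'a::real_normed_vector set \<Rightarrow> 'a \<Rightarrow> 'a set" where
  "tangent_space M x =
     {v. \<exists>\<gamma> \<epsilon>. (\<epsilon>::real) > 0 \<and> Ck_on 1 {-\<epsilon><..<\<epsilon>} \<gamma> \<and> \<gamma> ` {-\<epsilon><..<\<epsilon>} \<subseteq> M \<and>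
        \<gamma> 0 = x \<and> (\<gamma> has_vector_derivative v) (at 0)}"

text \<open>The differential of \<open>Q\<close> at \<open>x\<close> is the restriction to the tangent space of the derivative of
  a local extension; this restriction does not depend on the extension. Meant for \<open>k \<ge> 1\<close>.\<close>

definition Ck_embedding ::
  "enat \<Rightarrow> 'a::real_normed_vector set \<Rightarrow> ('a \<Rightarrow> 'b::real_normed_vector) \<Rightarrow> bool" where
  "Ck_embedding k M Q \<longleftrightarrow>
     Ck_map k M Q \<and>
     (\<exists>R. homeomorphism M (Q ` M) Q R) \<and>
     (\<forall>x\<in>M. \<exists>g. Ck_extension k M Q x g \<and>
        inj_on (frechet_derivative g (at x)) (tangent_space M x))"

definition J :: "complex \<times> complex \<times> complex \<Rightarrow> complex \<times> complex \<times> complex" where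
  "J = (\<lambda>(a, b, c). (\<i> * a, \<i> * b, \<i> * c))"

definition complex_tangents ::
  "(complex \<times> complex \<times> complex) set \<Rightarrow> (complex \<times> complex \<times> complex) set" where
  "complex_tangents M = {x\<in>M. tangent_space M x \<inter> J ` tangent_space M x \<noteq> {0}}"

text \<open>The complex tangents of \<open>Q ` S3\<close>, regarded as a subset of \<open>S3\<close> via \<open>Q\<close>.\<close>

definition complex_tangents_in_S3 ::
  "(complex \<times> complex \<Rightarrow> complex \<times> complex \<times> complex) \<Rightarrow> (complex \<times> complex) set" where
  "complex_tangents_in_S3 Q = {x\<in>S3. Q x \<in> complex_tangents (Q ` S3)}"

text \<open>Knots are only required to be continuous, so wild knots are included. The circle is
  compact, so a continuous injection of it is a topological embedding.\<close>

definition is_knot :: "(complex \<times> complex) set \<Rightarrow> bool" where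
  "is_knot K \<longleftrightarrow> K \<subseteq> S3 \<and>
     (\<exists>\<gamma>. continuous_on (sphere (0::complex) 1) \<gamma> \<and> inj_on \<gamma> (sphere 0 1) \<and>
          \<gamma> ` sphere 0 1 = K)"

definition knot_equivalent :: "(complex \<times> complex) set \<Rightarrow> (complex \<times> complex) set \<Rightarrow> bool" where
  "knot_equivalent K\<^sub>1 K\<^sub>2 \<longleftrightarrow> (\<exists>h h'. homeomorphism S3 S3 h h' \<and> h ` K\<^sub>1 = K\<^sub>2)"

text \<open>The iterated derivative of \<open>f\<close> along the given directions is defined at \<open>x\<close>.\<close>

primrec iter_differentiable_at ::
  "'a::real_normed_vector list \<Rightarrow> ('a \<Rightarrow> 'b::real_normed_vector) \<Rightarrow> 'a \<Rightarrow> bool" where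
  "iter_differentiable_at [] f x \<longleftrightarrow> True"
| "iter_differentiable_at (v # vs) f x \<longleftrightarrow>
     (\<forall>\<^sub>F y in nhds x. iter_differentiable_at vs f y) \<and> iter_deriv vs f differentiable (at x)"

text \<open>The extension of a function on the unit sphere that is constant along rays. Its derivatives
  at a point of the sphere of orders \<open>1, \<dots>, k\<close> all vanish iff those of the function on
  the sphere, taken in charts, do.\<close>

definition radial_extension :: "('a::real_normed_vector \<Rightarrow> 'b) \<Rightarrow> 'a \<Rightarrow> 'b" where
  "radial_extension q x = q (x /\<^sub>R norm x)"

definition degenerate_at :: "(complex \<times> complex \<Rightarrow> complex) \<Rightarrow> complex \<times> complex \<Rightarrow> bool" where
  "degenerate_at q p \<longleftrightarrow>
     (\<forall>vs. vs \<noteq> [] \<longrightarrow> iter_differentiable_at vs (radial_extension q) p \<longrightarrow>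
        iter_deriv vs (radial_extension q) p = 0)"

end

theory Submission
  imports Defs
begin

text \<open>The graph of \<open>q\<close> has a complex tangent at a point of the sphere iff the tangential
  Cauchy-Riemann operator \<open>L\<close> kills \<open>q\<close> there. The condition \<open>L q \<noteq> 0\<close> excludes a single point of
  the plane, hence is ample, and convex integration produces a smooth \<open>q\<close> that is flat on an
  arbitrary closed set \<open>K\<close> through the pole \<open>(0, 1)\<close> and has \<open>L q \<noteq> 0\<close> off \<open>K\<close>; a rotation moves a
  point of the knot to the pole, so wild knots need no separate treatment.

  The phase is \<open>x = Re (z / (1 - w))\<close>, for which \<open>\<bar>L x\<bar> = 1 / \<bar>1 - w\<bar>\<close> never vanishes. In the
  shell where a weight \<open>\<rho>\<close> vanishing exactly on \<open>K\<close> is of size \<open>2\<^sup>-\<^sup>k\<close>, \<open>q\<close> is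
  \<open>2\<^sup>-\<^sup>k\<^sup>*\<^sup>k \<Gamma> (N x) / N\<close> with \<open>N = B\<^sup>k\<close>, where \<open>\<Gamma>'\<close> is a loop of mean zero around which \<open>L q\<close> runs.
  Since the loop contracts to the constant 1 in the punctured plane, the oscillation of the next
  shell is switched on as a factor of \<open>L q\<close> before the previous one is switched off, and \<open>L q\<close>
  never passes through 0 if \<open>B\<close> is large. The amplitudes decay faster than any power of the
  frequencies, which gives smoothness and flatness on \<open>K\<close>.\<close>

section \<open>Sequences with geometrically growing derivatives\<close>

text \<open>The obstacle is uniformity in \<open>k\<close>. Cutoffs on ever thinner shells have
  derivatives growing geometrically, and consecutive amplitudes differ by the unbounded factor
  2^(2k+1). The first point is met by \<open>moderate_upto\<close>: derivatives up to order
  \<open>m\<close> of the \<open>k\<close>-th function are at most \<open>L ^ Suc k\<close>, with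
  \<open>L\<close> depending on the order and the directions. This class is stable under products,
  inverses of functions bounded below, and oscillation at geometric frequency. Summing it against
  2^(-k^2) loses nothing, and a constant sequence belonging to it for all \<open>m\<close> is how
  smoothness is expressed. The second point is met by the shape of the loop: for nonnegative a, b
  the modulus of a + b \<open>loop s\<close> is at least (a + b)/4, whatever the ratio of a to b.
  Independent oscillations that are simply added could cancel; when the incoming one multiplies the
  outgoing one, the latter becomes a common factor and only such a combination remains. The phase is
  singular at the pole, so the pole is put on the knot, and a weight dominated by |1 - w|^2 keeps
  every shell at a definite distance from it.\<close>

primrec moderate_upto ::
  "'a::euclidean_space set \<Rightarrow> nat \<Rightarrow> (nat \<Rightarrow> 'a \<Rightarrow> 'b::real_normed_vector) \<Rightarrow> bool" where
  "moderate_upto W 0 F \<longleftrightarrow> (\<exists>L\<ge>1. \<forall>k. \<forall>x\<in>W. norm (F k x) \<le> L ^ Suc k)"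
| "moderate_upto W (Suc m) F \<longleftrightarrow> (\<exists>L\<ge>1. \<forall>k. \<forall>x\<in>W. norm (F k x) \<le> L ^ Suc k) \<and>
     (\<forall>k. \<forall>x\<in>W. F k differentiable (at x)) \<and>
     (\<forall>v. moderate_upto W m (\<lambda>k x. frechet_derivative (F k) (at x) v))"

lemma moderate_upto_0: "moderate_upto W m F \<Longrightarrow> moderate_upto W 0 F"
  by (cases m) auto

lemma moderate_upto_Suc: "moderate_upto W (Suc m) F \<Longrightarrow> moderate_upto W m F"
proof (induction m arbitrary: F)
  case 0
  then show ?case by simp
next
  case (Suc m)
  show ?case
    using Suc.prems Suc.IH[of "\<lambda>k x. frechet_derivative (F k) (at x) _"]
    by (metis moderate_upto.simps(2))
qed

lemma frechet_derivative_cong_open: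
  assumes "open W" "x \<in> W" "\<And>y. y \<in> W \<Longrightarrow> f y = g y"
  shows "frechet_derivative f (at x) = frechet_derivative g (at x)"
proof -
  have "(f has_derivative D) (at x) \<longleftrightarrow> (g has_derivative D) (at x)" for D
    using has_derivative_transform_within_open[of f D x UNIV W g]
      has_derivative_transform_within_open[of g D x UNIV W f] assms by auto
  then show ?thesis
    by (simp add: frechet_derivative_def)
qed

lemma differentiable_cong_open:
  assumes "open W" "x \<in> W" "\<And>y. y \<in> W \<Longrightarrow> f y = g y" "f differentiable (at x)"
  shows "g differentiable (at x)"
  using assms has_derivative_transform_within_open[of f _ x UNIV W g]
  unfolding differentiable_def by blast

lemma moderate_upto_cong:
  assumes "open W" "moderate_upto W m F" "\<And>k x. x \<in> W \<Longrightarrow> F k x = G k x"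
  shows "moderate_upto W m G"
  using assms(2,3)
proof (induction m arbitrary: F G)
  case 0
  then show ?case by simp
next
  case (Suc m)
  have "moderate_upto W m (\<lambda>k x. frechet_derivative (G k) (at x) v)" for v
    by (rule Suc.IH[of "\<lambda>k x. frechet_derivative (F k) (at x) v"])
      (use Suc.prems in \<open>auto intro!: fun_cong[OF frechet_derivative_cong_open[OF assms(1)]]\<close>)
  moreover have "G k differentiable (at x)" if "x \<in> W" for k x
    using differentiable_cong_open[OF assms(1) that, of "F k" "G k"] Suc.prems that by auto
  ultimately show ?case
    using Suc.prems by auto
qed

text \<open>Any formula \<open>F'\<close> for the derivative is accepted, so that most closure
  lemmas below can induct on \<open>m\<close> and feed in the Leibniz, quotient or chain rule
  directly. Openness of \<open>W\<close> allows \<open>F'\<close> to be exchanged for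
  \<open>frechet_derivative\<close> afterwards.\<close>

lemma moderate_upto_SucI:
  assumes "open W" "moderate_upto W 0 F"
    and "\<And>k x. x \<in> W \<Longrightarrow> (F k has_derivative (\<lambda>v. F' v k x)) (at x)"
    and "\<And>v. moderate_upto W m (F' v)"
  shows "moderate_upto W (Suc m) F"
proof -
  have "moderate_upto W m (\<lambda>k x. frechet_derivative (F k) (at x) v)" for v
    by (rule moderate_upto_cong[OF assms(1) assms(4)[of v]])
      (metis assms(3) frechet_derivative_at)
  then show ?thesis
    using assms(2,3) by (auto simp: differentiable_def)
qed

lemma moderate_upto_SucD:
  assumes "moderate_upto W (Suc m) F" "x \<in> W"
  shows "(F k has_derivative (\<lambda>v. frechet_derivative (F k) (at x) v)) (at x)"
  using assms by (auto simp: frechet_derivative_works[symmetric])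

lemma moderate_uptoI0:
  assumes "L \<ge> 1" "\<And>k x. x \<in> W \<Longrightarrow> norm (F k x) \<le> L ^ Suc k"
  shows "moderate_upto W 0 F"
  using assms by auto

lemma moderate_uptoE0:
  assumes "moderate_upto W m F"
  obtains L where "L \<ge> 1" "\<And>k x. x \<in> W \<Longrightarrow> norm (F k x) \<le> L ^ Suc k"
  using moderate_upto_0[OF assms] by auto

lemma moderate_upto_const_bound:
  assumes "\<And>k x. x \<in> W \<Longrightarrow> norm (F k x) \<le> C"
  shows "moderate_upto W 0 F"
proof (rule moderate_uptoI0)
  show "1 \<le> max 1 C" by simp
  fix k x assume "x \<in> W"
  then have "norm (F k x) \<le> max 1 C" using assms[of x k] by linarith
  also have "\<dots> \<le> max 1 C ^ Suc k" by (rule self_le_power) auto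
  finally show "norm (F k x) \<le> max 1 C ^ Suc k" .
qed

lemma moderate_upto_const:
  fixes c :: "nat \<Rightarrow> 'b::real_normed_vector"
  assumes "L \<ge> 1" "\<And>k. norm (c k) \<le> L ^ Suc k" "open W"
  shows "moderate_upto W m (\<lambda>k x. c k)"
  using assms(1,2)
proof (induction m arbitrary: c L)
  case 0
  then show ?case by auto
next
  case (Suc m)
  show ?case
  proof (rule moderate_upto_SucI[OF assms(3), where F' = "\<lambda>v k x. 0"])
    show "moderate_upto W 0 (\<lambda>k x. c k)" using Suc.prems by auto
    show "moderate_upto W m (\<lambda>k x. 0::'b)" by (rule Suc.IH[of 1]) auto
  qed auto
qed

lemma moderate_upto_add:
  assumes "open W" "moderate_upto W m F" "moderate_upto W m G"
  shows "moderate_upto W m (\<lambda>k x. F k x + G k x)"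
  using assms(2,3)
proof (induction m arbitrary: F G)
  case 0
  obtain L M where "L \<ge> 1" "M \<ge> 1" and L: "\<And>k x. x \<in> W \<Longrightarrow> norm (F k x) \<le> L ^ Suc k"
    and M: "\<And>k x. x \<in> W \<Longrightarrow> norm (G k x) \<le> M ^ Suc k"
    using moderate_uptoE0[OF 0(1)] moderate_uptoE0[OF 0(2)] by metis
  show ?case
  proof (rule moderate_uptoI0)
    show "1 \<le> L + M" using \<open>L \<ge> 1\<close> \<open>M \<ge> 1\<close> by simp
    fix k x assume x: "x \<in> W"
    have "L ^ Suc k + M ^ Suc k \<le> L * (L + M) ^ k + M * (L + M) ^ k"
      using \<open>L \<ge> 1\<close> \<open>M \<ge> 1\<close> by (auto intro!: add_mono mult_left_mono power_mono)
    then show "norm (F k x + G k x) \<le> (L + M) ^ Suc k"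
      using norm_triangle_ineq[of "F k x" "G k x"] L[OF x, of k] M[OF x, of k]
      by (simp add: algebra_simps)
  qed
next
  case (Suc m)
  show ?case
  proof (rule moderate_upto_SucI[OF assms(1)])
    show "moderate_upto W 0 (\<lambda>k x. F k x + G k x)"
      using moderate_upto_0[OF Suc.IH] Suc.prems moderate_upto_Suc by blast
    show "((\<lambda>x. F k x + G k x) has_derivative (\<lambda>v. frechet_derivative (F k) (at x) v +
        frechet_derivative (G k) (at x) v)) (at x)" if "x \<in> W" for k x
      by (intro has_derivative_add moderate_upto_SucD[OF Suc.prems(1) that] moderate_upto_SucD[OF Suc.prems(2) that])
    show "moderate_upto W m (\<lambda>k x. frechet_derivative (F k) (at x) v + frechet_derivative (G k) (at x) v)" for v
      by (rule Suc.IH) (use Suc.prems in auto)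
  qed
qed

lemma moderate_upto_mult:
  fixes F G :: "nat \<Rightarrow> 'a::euclidean_space \<Rightarrow> 'b::real_normed_algebra"
  assumes "open W" "moderate_upto W m F" "moderate_upto W m G"
  shows "moderate_upto W m (\<lambda>k x. F k x * G k x)"
  using assms(2,3)
proof (induction m arbitrary: F G)
  case 0
  obtain L M where "L \<ge> 1" "M \<ge> 1" and L: "\<And>k x. x \<in> W \<Longrightarrow> norm (F k x) \<le> L ^ Suc k"
    and M: "\<And>k x. x \<in> W \<Longrightarrow> norm (G k x) \<le> M ^ Suc k"
    using moderate_uptoE0[OF 0(1)] moderate_uptoE0[OF 0(2)] by metis
  show ?case
  proof (rule moderate_uptoI0)
    show "1 \<le> L * M" using mult_mono[of 1 L 1 M] \<open>L \<ge> 1\<close> \<open>M \<ge> 1\<close> by simp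
    fix k x assume x: "x \<in> W"
    have "norm (F k x * G k x) \<le> norm (F k x) * norm (G k x)" by (rule norm_mult_ineq)
    also have "\<dots> \<le> L ^ Suc k * M ^ Suc k"
      using L[OF x] M[OF x] \<open>L \<ge> 1\<close> by (intro mult_mono) auto
    finally show "norm (F k x * G k x) \<le> (L * M) ^ Suc k"
      by (simp only: power_mult_distrib)
  qed
next
  case (Suc m)
  have IH: "moderate_upto W m (\<lambda>k x. F k x * G k x)"
    if "moderate_upto W m F" "moderate_upto W m G" for F G :: "nat \<Rightarrow> 'a \<Rightarrow> 'b"
    using Suc.IH that by blast
  show ?case
  proof (rule moderate_upto_SucI[OF assms(1)])
    show "moderate_upto W 0 (\<lambda>k x. F k x * G k x)"
      using moderate_upto_0[OF IH] Suc.prems moderate_upto_Suc by blast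
    show "((\<lambda>x. F k x * G k x) has_derivative (\<lambda>v. F k x * frechet_derivative (G k) (at x) v +
        frechet_derivative (F k) (at x) v * G k x)) (at x)" if "x \<in> W" for k x
      by (intro has_derivative_mult moderate_upto_SucD[OF Suc.prems(1) that] moderate_upto_SucD[OF Suc.prems(2) that])
    show "moderate_upto W m (\<lambda>k x. F k x * frechet_derivative (G k) (at x) v +
        frechet_derivative (F k) (at x) v * G k x)" for v
      by (intro moderate_upto_add assms(1) IH) (use Suc.prems moderate_upto_Suc in auto)
  qed
qed

lemma moderate_upto_bounded_linear:
  assumes "open W" "bounded_linear T" "moderate_upto W m F"
  shows "moderate_upto W m (\<lambda>k x. T (F k x))"
  using assms(3)
proof (induction m arbitrary: F)
  case 0
  obtain L where "L \<ge> 1" and L: "\<And>k x. x \<in> W \<Longrightarrow> norm (F k x) \<le> L ^ Suc k"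
    using moderate_uptoE0[OF 0(1)] by metis
  obtain C where C: "C > 0" "\<And>x. norm (T x) \<le> norm x * C"
    using bounded_linear.pos_bounded[OF assms(2)] by blast
  show ?case
  proof (rule moderate_uptoI0)
    have le: "L \<le> L * max 1 C" using \<open>L \<ge> 1\<close> by simp
    show "1 \<le> L * max 1 C" using le \<open>L \<ge> 1\<close> by linarith
    fix k x assume x: "x \<in> W"
    have "norm (T (F k x)) \<le> norm (F k x) * C" by (rule C)
    also have "\<dots> \<le> L ^ Suc k * (max 1 C) ^ Suc k"
    proof (intro mult_mono L[OF x])
      have "max 1 C \<le> max 1 C ^ Suc k" by (rule self_le_power) auto
      then show "C \<le> max 1 C ^ Suc k" by simp
    qed (use \<open>L \<ge> 1\<close> C in auto)
    finally show "norm (T (F k x)) \<le> (L * max 1 C) ^ Suc k"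
      by (simp only: power_mult_distrib)
  qed
next
  case (Suc m)
  show ?case
  proof (rule moderate_upto_SucI[OF assms(1)])
    show "moderate_upto W 0 (\<lambda>k x. T (F k x))"
      using moderate_upto_0[OF Suc.IH] Suc.prems moderate_upto_Suc by blast
    show "((\<lambda>x. T (F k x)) has_derivative (\<lambda>v. T (frechet_derivative (F k) (at x) v))) (at x)"
      if "x \<in> W" for k x
      by (intro bounded_linear.has_derivative[OF assms(2)] moderate_upto_SucD[OF Suc.prems that])
    show "moderate_upto W m (\<lambda>k x. T (frechet_derivative (F k) (at x) v))" for v
      by (rule Suc.IH) (use Suc.prems in auto)
  qed
qed

lemma moderate_upto_shift:
  assumes "moderate_upto W m F"
  shows "moderate_upto W m (\<lambda>k. F (Suc k))"
  using assms
proof (induction m arbitrary: F)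
  case 0
  obtain L where "L \<ge> 1" and L: "\<And>k x. x \<in> W \<Longrightarrow> norm (F k x) \<le> L ^ Suc k"
    using moderate_uptoE0[OF 0(1)] by metis
  show ?case
  proof (rule moderate_uptoI0)
    show "1 \<le> L\<^sup>2" using \<open>L \<ge> 1\<close> by simp
    fix k x assume x: "x \<in> W"
    have "norm (F (Suc k) x) \<le> L ^ Suc (Suc k)" by (rule L[OF x])
    also have "\<dots> \<le> L ^ (2 * Suc k)" using \<open>L \<ge> 1\<close> by (intro power_increasing) auto
    finally show "norm (F (Suc k) x) \<le> (L\<^sup>2) ^ Suc k" by (simp only: power_mult)
  qed
next
  case (Suc m)
  have 0: "moderate_upto W 0 (\<lambda>k. F (Suc k))"
    using moderate_upto_0[OF Suc.IH] Suc.prems moderate_upto_Suc by blast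
  show ?case using Suc.prems Suc.IH[of "\<lambda>k x. frechet_derivative (F k) (at x) _"] 0
    by auto
qed

lemma moderate_upto_inverse:
  fixes F :: "nat \<Rightarrow> 'a::euclidean_space \<Rightarrow> real"
  assumes "open W" "moderate_upto W m F" "c > 0" "\<And>k x. x \<in> W \<Longrightarrow> F k x \<ge> c"
  shows "moderate_upto W m (\<lambda>k x. inverse (F k x))"
proof -
  have b0: "moderate_upto W 0 (\<lambda>k x. inverse (F k x))"
  proof (rule moderate_upto_const_bound)
    fix k x assume "x \<in> W"
    then have "F k x \<ge> c" by (rule assms(4))
    then show "norm (inverse (F k x)) \<le> inverse c" using \<open>c > 0\<close> by (simp add: field_simps)
  qed
  show ?thesis
    using assms(2)
  proof (induction m)
    case 0
    show ?case by (rule b0)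
  next
    case (Suc m)
    show ?case
    proof (rule moderate_upto_SucI[OF assms(1) b0])
      show "((\<lambda>x. inverse (F k x)) has_derivative (\<lambda>v. (- 1) * (inverse (F k x) *
          frechet_derivative (F k) (at x) v * inverse (F k x)))) (at x)" if "x \<in> W" for k x
      proof -
        have "F k x \<noteq> 0" using assms(3) assms(4)[OF that, of k] by linarith
        from Deriv.has_derivative_inverse[OF this moderate_upto_SucD[OF Suc.prems that]] show ?thesis by simp
      qed
      have I: "moderate_upto W m (\<lambda>k x. inverse (F k x))"
        by (rule Suc.IH[OF moderate_upto_Suc[OF Suc.prems]])
      show "moderate_upto W m (\<lambda>k x. (- 1) * (inverse (F k x) *
          frechet_derivative (F k) (at x) v * inverse (F k x)))" for v
        by (intro moderate_upto_mult assms(1) I moderate_upto_const[of 1]) (use Suc.prems in auto)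
    qed
  qed
qed

text \<open>\<open>\<phi>\<close> is a tower, each function being the derivative of the previous
  one. Differentiating \<open>\<phi> j (F k x)\<close> produces \<open>\<phi> (Suc j)\<close>, so
  the induction on \<open>m\<close> runs for all \<open>j\<close> at once. Boundedness on the whole
  line makes the values harmless however fast \<open>F k\<close> grows.\<close>

lemma moderate_upto_chain:
  fixes F :: "nat \<Rightarrow> 'a::euclidean_space \<Rightarrow> real" and \<phi> :: "nat \<Rightarrow> real \<Rightarrow> real"
  assumes "open W" "moderate_upto W m F"
    and bd: "\<And>j. \<exists>C. \<forall>t. \<bar>\<phi> j t\<bar> \<le> C"
    and der: "\<And>j t. (\<phi> j has_real_derivative \<phi> (Suc j) t) (at t)"
  shows "moderate_upto W m (\<lambda>k x. \<phi> j (F k x))"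
proof -
  have b0: "moderate_upto W 0 (\<lambda>k x. \<phi> j (F k x))" for j
    using bd[of j] moderate_upto_const_bound[of W "\<lambda>k x. \<phi> j (F k x)"] by auto
  show ?thesis
    using assms(2)
  proof (induction m arbitrary: j)
    case 0
    show ?case by (rule b0)
  next
    case (Suc m)
    show ?case
    proof (rule moderate_upto_SucI[OF assms(1) b0])
      show "((\<lambda>x. \<phi> j (F k x)) has_derivative (\<lambda>v. \<phi> (Suc j) (F k x) *
          frechet_derivative (F k) (at x) v)) (at x)" if "x \<in> W" for k x
        using DERIV_compose_FDERIV[OF der moderate_upto_SucD[OF Suc.prems that]]
        by (simp add: mult.commute)
      show "moderate_upto W m (\<lambda>k x. \<phi> (Suc j) (F k x) * frechet_derivative (F k) (at x) v)" for v
        by (intro moderate_upto_mult assms(1) Suc.IH moderate_upto_Suc[OF Suc.prems]) (use Suc.prems in auto)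
    qed
  qed
qed

lemma moderate_upto_sin_cos:
  fixes F :: "nat \<Rightarrow> 'a::euclidean_space \<Rightarrow> real"
  assumes "open W" "moderate_upto W m F"
  shows "moderate_upto W m (\<lambda>k x. sin (F k x))" "moderate_upto W m (\<lambda>k x. cos (F k x))"
proof -
  have *: "moderate_upto W m (\<lambda>k x. sin (F k x + real j * (pi / 2)))" for j
  proof (rule moderate_upto_chain[OF assms, of "\<lambda>j t. sin (t + real j * (pi / 2))"])
    show "\<exists>C. \<forall>t. \<bar>sin (t + real j * (pi / 2))\<bar> \<le> C" for j
      by (rule exI[of _ 1]) simp
    show "((\<lambda>t. sin (t + real j * (pi / 2))) has_real_derivative sin (t + real (Suc j) * (pi / 2))) (at t)"
      for j t
    proof -
      have "sin (t + real (Suc j) * (pi / 2)) = sin (t + real j * (pi / 2) + pi / 2)"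
        by (simp add: field_simps)
      also have "\<dots> = cos (t + real j * (pi / 2))" by (simp add: sin_add)
      finally show ?thesis by (auto intro!: derivative_eq_intros)
    qed
  qed
  show "moderate_upto W m (\<lambda>k x. sin (F k x))" using *[of 0] by simp
  show "moderate_upto W m (\<lambda>k x. cos (F k x))" using *[of 1] by (simp add: sin_add)
qed

section \<open>Rapidly weighted series\<close>

text \<open>The \<open>k\<close>-th term is L (L / 2^k)^k, hence at most L / 2^k as soon as 2^k >= 2
  L.\<close>

lemma summable_weight:
  assumes "L \<ge> (1::real)"
  shows "summable (\<lambda>k. (1/2) ^ (k * k) * L ^ Suc k)"
proof -
  have "summable (\<lambda>k. L * (1/2::real) ^ k)"
    by (intro summable_mult summable_geometric) simp
  moreover have "\<exists>N. \<forall>k\<ge>N. norm ((1/2) ^ (k * k) * L ^ Suc k) \<le> L * (1/2) ^ k"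
  proof -
    obtain N where N: "2 * L < 2 ^ N" using real_arch_pow[of 2 "2 * L"] by auto
    show ?thesis
    proof (intro exI allI impI)
      fix k assume "N \<le> k"
      then have "(2::real) ^ N \<le> 2 ^ k" by (intro power_increasing) auto
      with N have "2 * L \<le> 2 ^ k" by linarith
      then have le: "(1/2) ^ k * L \<le> 1 / 2" by (simp add: field_simps)
      have "norm ((1/2) ^ (k * k) * L ^ Suc k) = L * ((1/2) ^ k * L) ^ k"
        using assms by (simp add: power_mult power_mult_distrib abs_mult)
      also have "\<dots> \<le> L * (1/2) ^ k"
        using assms le by (intro mult_left_mono power_mono) auto
      finally show "norm ((1/2) ^ (k * k) * L ^ Suc k) \<le> L * (1/2) ^ k" .
    qed
  qed
  ultimately show ?thesis by (rule summable_comparison_test[rotated])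
qed

text \<open>\<open>moderate_upto\<close> provides one \<open>L\<close> per direction. Expanding
  \<open>v\<close> in the basis and adding the finitely many constants turns them into an operator
  bound, the uniformity in \<open>v\<close> that termwise differentiation needs.\<close>

lemma moderate_upto_frechet_bound:
  assumes "moderate_upto W (Suc m) F"
  obtains L where "L \<ge> 1"
    "\<And>k x v. x \<in> W \<Longrightarrow> norm (frechet_derivative (F k) (at x) v) \<le> L ^ Suc k * norm v"
proof -
  have "\<exists>L\<ge>1. \<forall>k. \<forall>x\<in>W. norm (frechet_derivative (F k) (at x) b) \<le> L ^ Suc k" for b
  proof -
    have "moderate_upto W m (\<lambda>k x. frechet_derivative (F k) (at x) b)" using assms by auto
    from moderate_upto_0[OF this] show ?thesis by simp
  qed
  then obtain L where L1: "\<And>b. L b \<ge> 1"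
    and L: "\<And>b k x. x \<in> W \<Longrightarrow> norm (frechet_derivative (F k) (at x) b) \<le> L b ^ Suc k"
    by metis
  define S where "S = (\<Sum>b\<in>Basis. L b)"
  have LS: "L b \<le> S" if "b \<in> Basis" for b
    unfolding S_def using that L1 by (intro member_le_sum) (auto intro: order_trans[OF zero_le_one])
  show ?thesis
  proof (rule that)
    obtain b :: 'a where "b \<in> Basis" using nonempty_Basis by blast
    then show "S \<ge> 1" using LS[of b] L1[of b] by linarith
    fix k x v assume x: "x \<in> W"
    let ?D = "frechet_derivative (F k) (at x)"
    interpret bounded_linear ?D
      using moderate_upto_SucD[OF assms x] has_derivative_bounded_linear by blast
    have "?D v = ?D (\<Sum>b\<in>Basis. (v \<bullet> b) *\<^sub>R b)" by (simp only: euclidean_representation)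
    also have "\<dots> = (\<Sum>b\<in>Basis. (v \<bullet> b) *\<^sub>R ?D b)" by (simp only: sum scaleR)
    also have "norm \<dots> \<le> (\<Sum>b\<in>Basis. norm v * (L b * S ^ k))"
    proof (intro sum_norm_le)
      fix b :: 'a assume b: "b \<in> Basis"
      have "norm (?D b) \<le> L b * L b ^ k" using L[OF x, of k b] by simp
      also have "\<dots> \<le> L b * S ^ k"
        using LS[OF b] L1[of b] by (intro mult_left_mono power_mono) auto
      finally show "norm ((v \<bullet> b) *\<^sub>R ?D b) \<le> norm v * (L b * S ^ k)"
        using Basis_le_norm[OF b, of v] by (simp add: mult_mono)
    qed
    also have "\<dots> = S ^ Suc k * norm v"
      by (simp add: S_def sum_distrib_left sum_distrib_right mult_ac)
    finally show "norm (?D v) \<le> S ^ Suc k * norm v" .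
  qed
qed

lemma weighted_series_abs:
  fixes F :: "nat \<Rightarrow> 'a::euclidean_space \<Rightarrow> 'b::banach"
  assumes "moderate_upto W m F" "x \<in> W"
  shows "summable (\<lambda>k. norm ((1/2) ^ (k * k) *\<^sub>R F k x))"
proof -
  obtain L where L: "L \<ge> 1" "\<And>k x. x \<in> W \<Longrightarrow> norm (F k x) \<le> L ^ Suc k"
    using moderate_uptoE0[OF assms(1)] by metis
  show ?thesis
  proof (rule summable_comparison_test)
    show "summable (\<lambda>k. (1/2) ^ (k * k) * L ^ Suc k)" by (rule summable_weight[OF L(1)])
    show "\<exists>N. \<forall>n\<ge>N. norm (norm ((1/2) ^ (n * n) *\<^sub>R F n x)) \<le> (1/2) ^ (n * n) * L ^ Suc n"
      using L(2)[OF assms(2)] by auto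
  qed
qed

text \<open>The operator bounds are summable against the weights, so the tails of the differentiated
  series tend to 0 uniformly on \<open>W\<close>. Passing to a ball inside \<open>W\<close> supplies
  the convex domain asked for by \<open>has_derivative_series\<close>.\<close>

lemma has_derivative_weighted_series:
  fixes F :: "nat \<Rightarrow> 'a::euclidean_space \<Rightarrow> 'b::banach"
  assumes "open W" "moderate_upto W (Suc m) F" "x \<in> W"
  shows "((\<lambda>x. \<Sum>k. (1/2) ^ (k * k) *\<^sub>R F k x) has_derivative
      (\<lambda>v. \<Sum>k. (1/2) ^ (k * k) *\<^sub>R frechet_derivative (F k) (at x) v)) (at x)"
proof -
  let ?a = "\<lambda>k. (1/2::real) ^ (k * k)"
  let ?D = "\<lambda>k y v. frechet_derivative (F k) (at y) v"
  obtain r where r: "r > 0" "ball x r \<subseteq> W" using assms(1,3) openE by blast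
  obtain L where L: "L \<ge> 1" "\<And>k x v. x \<in> W \<Longrightarrow> norm (?D k x v) \<le> L ^ Suc k * norm v"
    using moderate_upto_frechet_bound[OF assms(2)] by metis
  have sm: "summable (\<lambda>k. ?a k * L ^ Suc k)" by (rule summable_weight[OF L(1)])
  have le: "norm (?a k *\<^sub>R ?D k y v) \<le> ?a k * L ^ Suc k * norm v" if "y \<in> W" for k y v
    using L(2)[OF that, of k v] by (simp add: mult_left_mono)
  have sD: "summable (\<lambda>k. norm (?a k *\<^sub>R ?D k y v))" if "y \<in> W" for y v
    by (rule summable_comparison_test'[OF summable_mult2[OF sm, of "norm v"], of 0])
      (use le[OF that] in auto)
  have "\<exists>g. \<forall>y\<in>ball x r. (\<lambda>n. ?a n *\<^sub>R F n y) sums (g y) \<and>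
      (g has_derivative (\<lambda>v. \<Sum>k. ?a k *\<^sub>R ?D k y v)) (at y within ball x r)"
  proof (rule has_derivative_series)
    show "((\<lambda>y. ?a n *\<^sub>R F n y) has_derivative (\<lambda>v. ?a n *\<^sub>R ?D n y v)) (at y within ball x r)"
      if "y \<in> ball x r" for n y
      using that r by (intro has_derivative_scaleR_right has_derivative_at_withinI[OF
        moderate_upto_SucD[OF assms(2)]]) auto
    show "(\<lambda>n. ?a n *\<^sub>R F n x) sums (\<Sum>n. ?a n *\<^sub>R F n x)"
      by (rule summable_sums[OF summable_norm_cancel[OF weighted_series_abs[OF assms(2,3)]]])
    show "\<forall>\<^sub>F n in sequentially. \<forall>y\<in>ball x r. \<forall>h.
        norm ((\<Sum>i<n. ?a i *\<^sub>R ?D i y h) - (\<Sum>k. ?a k *\<^sub>R ?D k y h)) \<le> e * norm h" if "e > 0" for e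
    proof -
      have "\<forall>\<^sub>F n in sequentially. norm (\<Sum>k. ?a (k + n) * L ^ Suc (k + n)) < e"
        using suminf_exist_split[OF that sm] by (auto simp: eventually_sequentially)
      then show ?thesis
      proof (rule eventually_mono, intro ballI allI)
        fix n y h assume n: "norm (\<Sum>k. ?a (k + n) * L ^ Suc (k + n)) < e" and "y \<in> ball x r"
        then have y: "y \<in> W" using r by auto
        have sn: "summable (\<lambda>k. ?a (k + n) * L ^ Suc (k + n))"
          by (rule summable_ignore_initial_segment[OF sm])
        have sDn: "summable (\<lambda>k. norm (?a (k + n) *\<^sub>R ?D (k + n) y h))"
          by (rule summable_ignore_initial_segment[OF sD[OF y]])
        have "norm ((\<Sum>i<n. ?a i *\<^sub>R ?D i y h) - (\<Sum>k. ?a k *\<^sub>R ?D k y h)) =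
            norm (\<Sum>k. ?a (k + n) *\<^sub>R ?D (k + n) y h)"
          using suminf_split_initial_segment[OF summable_norm_cancel[OF sD[OF y]], of h n]
          by (simp add: norm_minus_commute)
        also have "\<dots> \<le> (\<Sum>k. norm (?a (k + n) *\<^sub>R ?D (k + n) y h))"
          by (rule summable_norm[OF sDn])
        also have "\<dots> \<le> (\<Sum>k. ?a (k + n) * L ^ Suc (k + n) * norm h)"
          by (rule suminf_le[OF _ sDn summable_mult2[OF sn]]) (rule le[OF y])
        also have "\<dots> = (\<Sum>k. ?a (k + n) * L ^ Suc (k + n)) * norm h"
          by (rule suminf_mult2[OF sn, symmetric])
        also have "\<dots> \<le> e * norm h" using n by (intro mult_right_mono) auto
        finally show "norm ((\<Sum>i<n. ?a i *\<^sub>R ?D i y h) - (\<Sum>k. ?a k *\<^sub>R ?D k y h)) \<le> e * norm h" .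
      qed
    qed
  qed (use r in auto)
  then obtain g where g: "\<And>y. y \<in> ball x r \<Longrightarrow> (\<lambda>n. ?a n *\<^sub>R F n y) sums (g y)"
    "(g has_derivative (\<lambda>v. \<Sum>k. ?a k *\<^sub>R ?D k x v)) (at x within ball x r)"
    using centre_in_ball[of x r] r(1) by meson
  from g(2) have "(g has_derivative (\<lambda>v. \<Sum>k. ?a k *\<^sub>R ?D k x v)) (at x)"
    using r at_within_open[of x "ball x r"] by simp
  then show ?thesis
    by (rule has_derivative_transform_within_open[of _ _ _ _ "ball x r"])
      (use g(1) r in \<open>auto simp: sums_iff\<close>)
qed

lemma moderate_upto_weighted_series:
  fixes F :: "nat \<Rightarrow> 'a::euclidean_space \<Rightarrow> 'b::banach"
  assumes "open W" "moderate_upto W m F"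
  shows "moderate_upto W m (\<lambda>_ x. \<Sum>k. (1/2) ^ (k * k) *\<^sub>R F k x)"
  using assms(2)
proof (induction m arbitrary: F)
  case 0
  obtain L where L: "L \<ge> 1" "\<And>k x. x \<in> W \<Longrightarrow> norm (F k x) \<le> L ^ Suc k"
    using moderate_uptoE0[OF 0] by metis
  show ?case
  proof (rule moderate_upto_const_bound)
    fix x assume x: "x \<in> W"
    have "norm (\<Sum>k. (1/2) ^ (k * k) *\<^sub>R F k x) \<le> (\<Sum>k. norm ((1/2::real) ^ (k * k) *\<^sub>R F k x))"
      by (rule summable_norm[OF weighted_series_abs[OF 0 x]])
    also have "\<dots> \<le> (\<Sum>k. (1/2) ^ (k * k) * L ^ Suc k)"
      using L(2)[OF x] by (intro suminf_le weighted_series_abs[OF 0 x] summable_weight[OF L(1)])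
        (auto intro: mult_left_mono)
    finally show "norm (\<Sum>k. (1/2::real) ^ (k * k) *\<^sub>R F k x) \<le> (\<Sum>k. (1/2) ^ (k * k) * L ^ Suc k)" .
  qed
next
  case (Suc m)
  show ?case
    by (rule moderate_upto_SucI[OF assms(1)
          moderate_upto_0[OF Suc.IH[OF moderate_upto_Suc[OF Suc.prems]]]
          has_derivative_weighted_series[OF assms(1) Suc.prems] Suc.IH])
      (use Suc.prems in auto)
qed

text \<open>\<open>iter_deriv\<close> recurses on the outermost derivative,
  \<open>moderate_upto\<close> on the innermost. This identity reconciles them: inductions peel off
  the innermost direction by \<open>rev_induct\<close>.\<close>

lemma iter_deriv_snoc:
  "iter_deriv (vs @ [v]) f = iter_deriv vs (\<lambda>x. frechet_derivative f (at x) v)"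
  by (induction vs) auto

lemma iter_deriv_cong_open:
  assumes "open W" "x \<in> W" "\<And>y. y \<in> W \<Longrightarrow> f y = g y"
  shows "iter_deriv vs f x = iter_deriv vs g x"
  using assms(2)
proof (induction vs arbitrary: x)
  case (Cons v vs)
  then show ?case
    using frechet_derivative_cong_open[OF assms(1) Cons.prems, of "iter_deriv vs f"] by simp
qed (use assms(3) in auto)

lemma iter_deriv_zero: "iter_deriv vs (\<lambda>x. 0) = (\<lambda>x. 0)"
  by (induction vs) auto

lemma moderate_upto_iter_deriv:
  assumes "moderate_upto W (m + length vs) F"
  shows "moderate_upto W m (\<lambda>k. iter_deriv vs (F k))"
  using assms
proof (induction vs arbitrary: F rule: rev_induct)
  case (snoc v vs)
  then show ?case
    using snoc.IH[of "\<lambda>k x. frechet_derivative (F k) (at x) v"] by (auto simp: iter_deriv_snoc)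
qed auto

lemma iter_deriv_weighted_series:
  fixes F :: "nat \<Rightarrow> 'a::euclidean_space \<Rightarrow> 'b::banach"
  assumes "open W" "moderate_upto W (length vs) F" "x \<in> W"
  shows "iter_deriv vs (\<lambda>x. \<Sum>k. (1/2) ^ (k * k) *\<^sub>R F k x) x =
    (\<Sum>k. (1/2) ^ (k * k) *\<^sub>R iter_deriv vs (F k) x)"
  using assms(2,3)
proof (induction vs arbitrary: F x rule: rev_induct)
  case (snoc v vs)
  have m: "moderate_upto W (length vs) (\<lambda>k x. frechet_derivative (F k) (at x) v)"
    using snoc.prems by auto
  have "iter_deriv (vs @ [v]) (\<lambda>x. \<Sum>k. (1/2) ^ (k * k) *\<^sub>R F k x) x =
    iter_deriv vs (\<lambda>x. \<Sum>k. (1/2) ^ (k * k) *\<^sub>R frechet_derivative (F k) (at x) v) x"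
    unfolding iter_deriv_snoc
  proof (rule iter_deriv_cong_open[OF assms(1) snoc.prems(2)])
    fix y assume y: "y \<in> W"
    have "moderate_upto W (Suc (length vs)) F" using snoc.prems(1) by simp
    from has_derivative_weighted_series[OF assms(1) this y]
    show "frechet_derivative (\<lambda>x. \<Sum>k. (1/2) ^ (k * k) *\<^sub>R F k x) (at y) v =
      (\<Sum>k. (1/2) ^ (k * k) *\<^sub>R frechet_derivative (F k) (at y) v)"
      by (rule fun_cong[OF frechet_derivative_at[symmetric]])
  qed
  also have "\<dots> = (\<Sum>k. (1/2) ^ (k * k) *\<^sub>R iter_deriv (vs @ [v]) (F k) x)"
    unfolding iter_deriv_snoc by (rule snoc.IH[OF m snoc.prems(2)])
  finally show ?case .
qed auto

lemma Ck_on_moderate: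
  assumes "\<And>m. moderate_upto W m (\<lambda>_. f)"
  shows "Ck_on k W f"
proof -
  have "iter_deriv vs f differentiable (at x)" if "x \<in> W" for vs x
    using moderate_upto_iter_deriv[OF assms, of 1 vs] that by simp
  then show ?thesis
    unfolding Ck_on_def by (auto intro!: continuous_at_imp_continuous_on differentiable_imp_continuous_within)
qed

section \<open>Cutoff functions\<close>

text \<open>The Schwartz flat functions: differentiating \<open>p (1 / t) * exp (- 1 / t)\<close> replaces the
  polynomial \<open>p\<close> by \<open>X\<^sup>2 (p - p')\<close>.\<close>

definition flat_poly :: "real poly \<Rightarrow> real \<Rightarrow> real" where
  "flat_poly p t = (if t > 0 then poly p (1 / t) * exp (- (1 / t)) else 0)"

abbreviation flat_exp :: "real \<Rightarrow> real" where "flat_exp \<equiv> flat_poly 1"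

text \<open>The free power \<open>y ^ n\<close> closes the induction: removing the constant
  coefficient of \<open>pCons a p\<close> raises the exponent by one. What remains is y^n <= n! exp
  y, a single term of the exponential series.\<close>

lemma poly_times_exp_bounded:
  fixes p :: "real poly"
  shows "\<exists>C. \<forall>y\<ge>0. \<bar>y ^ n * poly p y * exp (- y)\<bar> \<le> C"
proof (induction p arbitrary: n)
  case 0
  show ?case by (rule exI[of _ "0::real"]) auto
next
  case (pCons a p)
  have mon: "y ^ n * exp (- y) \<le> fact n" if "y \<ge> 0" for y :: real
  proof -
    have "(\<Sum>i\<in>{n}. y ^ i /\<^sub>R fact i) \<le> exp y"
      unfolding exp_def using that by (intro sum_le_suminf summable_exp_generic) auto
    then show ?thesis by (simp add: exp_minus field_simps)
  qed
  obtain C where C: "\<And>y. y \<ge> 0 \<Longrightarrow> \<bar>y ^ Suc n * poly p y * exp (- y)\<bar> \<le> C"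
    using pCons.IH[of "Suc n"] by blast
  show ?case
  proof (intro exI allI impI)
    fix y :: real assume y: "y \<ge> 0"
    have "y ^ n * poly (pCons a p) y * exp (- y) =
        a * (y ^ n * exp (- y)) + y ^ Suc n * poly p y * exp (- y)"
      by (simp add: algebra_simps)
    also have "\<bar>\<dots>\<bar> \<le> \<bar>a * (y ^ n * exp (- y))\<bar> + \<bar>y ^ Suc n * poly p y * exp (- y)\<bar>" by simp
    also have "\<bar>a * (y ^ n * exp (- y))\<bar> \<le> \<bar>a\<bar> * fact n"
      using mon[OF y] y by (simp add: abs_mult mult_left_mono)
    finally show "\<bar>y ^ n * poly (pCons a p) y * exp (- y)\<bar> \<le> \<bar>a\<bar> * fact n + C"
      using C[OF y] by linarith
  qed
qed

lemma flat_poly_bounded: "\<exists>C. \<forall>t. \<bar>flat_poly p t\<bar> \<le> C"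
proof -
  obtain C where C: "\<And>y. y \<ge> 0 \<Longrightarrow> \<bar>poly p y * exp (- y)\<bar> \<le> C"
    using poly_times_exp_bounded[of 0 p] by auto
  then have "\<bar>flat_poly p t\<bar> \<le> C" for t
    using C[of 0] C[of "1 / t"] by (auto simp: flat_poly_def)
  then show ?thesis by blast
qed

lemma DERIV_flat_poly:
  "(flat_poly p has_real_derivative flat_poly ([:0, 0, 1:] * (p - pderiv p)) t) (at t)"
proof -
  consider "t > 0" | "t < 0" | "t = 0" by linarith
  then show ?thesis
  proof cases
    case 1
    have "((\<lambda>t. poly p (1 / t) * exp (- (1 / t))) has_real_derivative
        flat_poly ([:0, 0, 1:] * (p - pderiv p)) t) (at t)"
      using 1 by (auto intro!: derivative_eq_intros DERIV_chain'[OF _ poly_DERIV]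
          simp: flat_poly_def field_simps power2_eq_square)
    then show ?thesis
      by (rule has_field_derivative_transform_within_open[of _ _ _ "{0<..}"])
        (use 1 in \<open>auto simp: flat_poly_def\<close>)
  next
    case 2
    have "((\<lambda>t. 0) has_real_derivative flat_poly ([:0, 0, 1:] * (p - pderiv p)) t) (at t)"
      using 2 by (simp add: flat_poly_def)
    then show ?thesis
      by (rule has_field_derivative_transform_within_open[of _ _ _ "{..<0}"])
        (use 2 in \<open>auto simp: flat_poly_def\<close>)
  next
    case 3
    \<comment> \<open>With y = 1/h this bound says that \<open>flat_poly p h\<close> is at most C
      h^2 in modulus, so the difference quotient at 0 is at most C |h|.\<close>
    obtain C where C: "\<And>y. y \<ge> 0 \<Longrightarrow> \<bar>y\<^sup>2 * poly p y * exp (- y)\<bar> \<le> C"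
      using poly_times_exp_bounded[of 2 p] by auto
    have C0: "C \<ge> 0" using C[of 0] by simp
    have "(\<lambda>h. flat_poly p h / h) \<midarrow>0\<rightarrow> 0"
    proof (rule Lim_null_comparison)
      show "\<forall>\<^sub>F h in at 0. norm (flat_poly p h / h) \<le> C * \<bar>h\<bar>"
      proof (intro always_eventually allI)
        fix h :: real
        show "norm (flat_poly p h / h) \<le> C * \<bar>h\<bar>"
          using C[of "1 / h"] C0 mult_nonneg_nonneg[OF C0, of "- h"]
          by (auto simp: flat_poly_def field_simps power2_eq_square abs_mult)
      qed
      show "(\<lambda>h. C * \<bar>h\<bar>) \<midarrow>0\<rightarrow> (0::real)" by (auto intro!: tendsto_eq_intros)
    qed
    then show ?thesis using 3 by (simp add: DERIV_def flat_poly_def)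
  qed
qed

lemma flat_exp_nonneg: "0 \<le> flat_exp t"
  and flat_exp_le_1: "flat_exp t \<le> 1"
  and flat_exp_eq_0_iff: "flat_exp t = 0 \<longleftrightarrow> t \<le> 0"
  by (auto simp: flat_poly_def)

lemma moderate_upto_flat_exp:
  fixes F :: "nat \<Rightarrow> 'a::euclidean_space \<Rightarrow> real"
  assumes "open W" "moderate_upto W m F"
  shows "moderate_upto W m (\<lambda>k x. flat_exp (F k x))"
proof -
  define P where "P = rec_nat 1 (\<lambda>_ p. [:0, 0, 1::real:] * (p - pderiv p))"
  have "moderate_upto W m (\<lambda>k x. flat_poly (P 0) (F k x))"
    by (rule moderate_upto_chain[OF assms, where \<phi> = "\<lambda>j. flat_poly (P j)"])
      (use flat_poly_bounded DERIV_flat_poly in \<open>auto simp: P_def\<close>)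
  then show ?thesis by (simp add: P_def)
qed

definition smooth_step :: "real \<Rightarrow> real" where
  "smooth_step t = flat_exp t * inverse (flat_exp t + flat_exp (1 - t))"

text \<open>One of \<open>t\<close> and \<open>1 - t\<close> is at least 1/2, where
  \<open>flat_exp\<close> is at least exp (-2). A uniform lower bound, not mere positivity, is what
  \<open>moderate_upto_inverse\<close> asks for.\<close>

lemma flat_exp_sum_ge: "flat_exp t + flat_exp (1 - t) \<ge> exp (- 2)"
proof (cases "t \<ge> 1 / 2")
  case True
  then have "exp (- 2) \<le> flat_exp t" by (simp add: flat_poly_def field_simps)
  then show ?thesis using flat_exp_nonneg[of "1 - t"] by linarith
next
  case False
  then have "exp (- 2) \<le> flat_exp (1 - t)" by (simp add: flat_poly_def field_simps)
  then show ?thesis using flat_exp_nonneg[of t] by linarith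
qed

lemma flat_exp_sum_pos: "flat_exp t + flat_exp (1 - t) > 0"
  using flat_exp_sum_ge[of t] by (smt (verit) exp_gt_zero)

lemma smooth_step_nonneg: "0 \<le> smooth_step t"
  and smooth_step_le_1: "smooth_step t \<le> 1"
  and smooth_step_eq_0: "t \<le> 0 \<Longrightarrow> smooth_step t = 0"
  and smooth_step_eq_1: "t \<ge> 1 \<Longrightarrow> smooth_step t = 1"
  using flat_exp_sum_pos[of t] flat_exp_nonneg[of t] flat_exp_nonneg[of "1 - t"]
    flat_exp_eq_0_iff[of t] flat_exp_eq_0_iff[of "1 - t"]
  by (auto simp: smooth_step_def field_simps)

lemma smooth_step_ge_half: "t \<ge> 1 / 2 \<Longrightarrow> smooth_step t \<ge> 1 / 2"
proof -
  assume t: "t \<ge> 1 / 2"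
  then have "flat_exp (1 - t) \<le> flat_exp t"
    by (auto simp: flat_poly_def field_simps)
  then show ?thesis
    using flat_exp_sum_pos[of t] by (simp add: smooth_step_def field_simps)
qed

lemma moderate_upto_smooth_step:
  fixes F :: "nat \<Rightarrow> 'a::euclidean_space \<Rightarrow> real"
  assumes "open W" "moderate_upto W m F"
  shows "moderate_upto W m (\<lambda>k x. smooth_step (F k x))"
proof -
  have "moderate_upto W m (\<lambda>k x. 1 + (- 1) * F k x)"
    by (intro moderate_upto_add moderate_upto_mult moderate_upto_const[of 1] assms) auto
  then have *: "moderate_upto W m (\<lambda>k x. 1 - F k x)" by simp
  show ?thesis
    unfolding smooth_step_def
    by (intro moderate_upto_mult moderate_upto_flat_exp assms * moderate_upto_add
        moderate_upto_inverse[where c = "exp (- 2)"] flat_exp_sum_ge) auto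
qed

text \<open>The breakpoints are tuned to doubling of the argument. Since 3 = 2 * (3/2), every
  positive number has exactly one dyadic multiple in [3/2, 3), where the value is 1. If u is that
  multiple, then u/2 can lie on the rising ramp between 1 and 3/2 only for u > 2, and 2 u on the
  falling ramp between 3 and 4 only for u < 2. So at most one neighbouring shell is active.\<close>

definition plateau :: "real \<Rightarrow> real" where
  "plateau u = smooth_step (2 * (u - 1)) * smooth_step (4 - u)"

lemma plateau_nonneg: "0 \<le> plateau u"
  by (simp add: plateau_def smooth_step_nonneg)

lemma plateau_le_1: "plateau u \<le> 1"
  unfolding plateau_def by (intro mult_le_one smooth_step_nonneg smooth_step_le_1)

lemma plateau_eq_0: "u \<le> 1 \<or> u \<ge> 4 \<Longrightarrow> plateau u = 0"
  by (auto simp: plateau_def smooth_step_eq_0)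

lemma plateau_eq_1: "3 / 2 \<le> u \<Longrightarrow> u \<le> 3 \<Longrightarrow> plateau u = 1"
  by (auto simp: plateau_def smooth_step_eq_1)

lemma moderate_upto_diff:
  fixes F G :: "nat \<Rightarrow> 'a::euclidean_space \<Rightarrow> 'b::real_normed_algebra_1"
  assumes "open W" "moderate_upto W m F" "moderate_upto W m G"
  shows "moderate_upto W m (\<lambda>k x. F k x - G k x)"
proof -
  have "moderate_upto W m (\<lambda>k x. F k x + (- 1) * G k x)"
    by (intro moderate_upto_add moderate_upto_mult moderate_upto_const[of 1] assms) auto
  then show ?thesis by simp
qed

lemma moderate_upto_constant:
  assumes "open W"
  shows "moderate_upto W m (\<lambda>k x. c)"
proof (rule moderate_upto_const[OF _ _ assms])
  show "1 \<le> max 1 (norm c)" by simp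
  show "norm c \<le> max 1 (norm c) ^ Suc k" for k
    using self_le_power[of "max 1 (norm c)" "Suc k"] by linarith
qed

lemma moderate_upto_plateau:
  fixes F :: "nat \<Rightarrow> 'a::euclidean_space \<Rightarrow> real"
  assumes "open W" "moderate_upto W m F"
  shows "moderate_upto W m (\<lambda>k x. plateau (F k x))"
  unfolding plateau_def
  by (intro moderate_upto_mult moderate_upto_smooth_step moderate_upto_diff moderate_upto_constant assms)

text \<open>Equals \<open>1 / s\<close> for \<open>s \<ge> 1\<close>, but is smooth and bounded for all \<open>s \<ge> 0\<close>.\<close>

definition capped_inverse :: "real \<Rightarrow> real" where
  "capped_inverse s = inverse (s + smooth_step (1 - s))"

lemma capped_inverse_eq: "s \<ge> 1 \<Longrightarrow> capped_inverse s = inverse s"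
  by (simp add: capped_inverse_def smooth_step_eq_0)

lemma moderate_upto_capped_inverse:
  fixes F :: "nat \<Rightarrow> 'a::euclidean_space \<Rightarrow> real"
  assumes "open W" "moderate_upto W m F" "\<And>k x. x \<in> W \<Longrightarrow> F k x \<ge> 0"
  shows "moderate_upto W m (\<lambda>k x. capped_inverse (F k x))"
proof -
  have "s + smooth_step (1 - s) \<ge> 1 / 2" if "s \<ge> 0" for s
    using smooth_step_nonneg[of "1 - s"] smooth_step_ge_half[of "1 - s"] that
    by (cases "s \<ge> 1 / 2") auto
  then show ?thesis
    unfolding capped_inverse_def
    by (intro moderate_upto_inverse[where c = "1 / 2"] moderate_upto_add moderate_upto_smooth_step
        moderate_upto_diff moderate_upto_constant assms) (use assms(3) in auto)
qed

section \<open>Weights vanishing on a closed subset of the sphere\<close>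

text \<open>An open neighbourhood of the sphere, bounded and bounded away from 0, so that
  normalisation of vectors has bounded derivatives of every order on it. Functions on the sphere are
  treated as functions here that are constant along rays.\<close>

definition annulus :: "'a::real_normed_vector set" where
  "annulus = {x. 1 / 2 < norm x \<and> norm x < 2}"

lemma open_annulus: "open annulus"
  unfolding annulus_def by (intro open_Collect_conj open_Collect_less continuous_intros)

lemma S3_eq_sphere: "S3 = sphere 0 1"
  by (auto simp: S3_def norm_Pair)

lemma S3_subset_annulus: "S3 \<subseteq> annulus"
  by (auto simp: S3_eq_sphere annulus_def)

section \<open>Smooth functions of the direction of a vector\<close>

lemma moderate_upto_inner:
  fixes a :: "nat \<Rightarrow> 'a::euclidean_space"
  assumes "\<And>k. norm (a k) \<le> 1"
  shows "moderate_upto annulus m (\<lambda>k x. a k \<bullet> x)"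
proof -
  have le: "\<bar>a k \<bullet> x\<bar> \<le> norm x" for k x
    using Cauchy_Schwarz_ineq2[of "a k" x] mult_right_mono[OF assms[of k] norm_ge_zero[of x]] by simp
  have 0: "moderate_upto annulus 0 (\<lambda>k x. a k \<bullet> x)"
  proof (rule moderate_upto_const_bound)
    fix k and x :: 'a assume "x \<in> annulus"
    then show "norm (a k \<bullet> x) \<le> 2" using le[of k x] by (simp add: annulus_def)
  qed
  show ?thesis
  proof (cases m)
    case (Suc n)
    have "moderate_upto annulus n (\<lambda>k x. a k \<bullet> v)" for v
    proof (rule moderate_upto_const[OF _ _ open_annulus])
      show "1 \<le> max 1 (norm v)" by simp
      show "norm (a k \<bullet> v) \<le> max 1 (norm v) ^ Suc k" for k
        using self_le_power[of "max 1 (norm v)" "Suc k"] le[of k v] by simp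
    qed
    then show ?thesis
      unfolding Suc by (intro moderate_upto_SucI[OF open_annulus 0]) (auto intro!: derivative_eq_intros)
  qed (use 0 in simp)
qed

lemma moderate_upto_inverse_norm:
  "moderate_upto (annulus :: 'a::euclidean_space set) m (\<lambda>_ x. inverse (norm x))"
proof (induction m)
  have b0: "moderate_upto annulus 0 (\<lambda>_ x::'a. inverse (norm x))"
    by (rule moderate_upto_const_bound[of _ _ 2]) (auto simp: annulus_def inverse_eq_divide divide_le_eq)
  {
    case 0
    show ?case by (rule b0)
  next
    case (Suc m)
    show ?case
    proof (rule moderate_upto_SucI[OF open_annulus b0])
      fix x :: 'a assume "x \<in> annulus"
      then have x: "x \<noteq> 0" by (auto simp: annulus_def)
      show "((\<lambda>x. inverse (norm x)) has_derivative (\<lambda>v. - 1 * (inverse (norm x) *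
          ((v \<bullet> x) * inverse (norm x)) * inverse (norm x)))) (at x)"
        by (rule has_derivative_eq_rhs[OF Deriv.has_derivative_inverse[OF _ has_derivative_norm[OF x]]])
          (use x in \<open>auto simp: sgn_div_norm inner_commute field_simps\<close>)
    next
      fix v :: 'a
      have "moderate_upto annulus m (\<lambda>k x. (norm v * ((v /\<^sub>R norm v) \<bullet> x)))"
        by (intro moderate_upto_mult open_annulus moderate_upto_constant moderate_upto_inner)
          (cases "v = 0"; simp)
      moreover have "(\<lambda>k::nat. \<lambda>x. norm v * ((v /\<^sub>R norm v) \<bullet> x)) = (\<lambda>k x. v \<bullet> x)"
        by (cases "v = 0") (auto simp: fun_eq_iff)
      ultimately have "moderate_upto annulus m (\<lambda>k x. v \<bullet> x)" by simp
      then show "moderate_upto annulus m (\<lambda>k x. - 1 * (inverse (norm x) *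
          ((v \<bullet> x) * inverse (norm x)) * inverse (norm x)))"
        by (intro moderate_upto_mult open_annulus moderate_upto_constant Suc)
    qed
  }
qed

lemma moderate_upto_inner_unit:
  fixes a :: "nat \<Rightarrow> 'a::euclidean_space"
  assumes "\<And>k. norm (a k) \<le> 1"
  shows "moderate_upto annulus m (\<lambda>k x. a k \<bullet> (x /\<^sub>R norm x))"
proof -
  have "moderate_upto annulus m (\<lambda>k x. (a k \<bullet> x) * inverse (norm x))"
    by (intro moderate_upto_mult open_annulus moderate_upto_inner moderate_upto_inverse_norm assms)
  then show ?thesis by (simp add: mult.commute)
qed

lemma moderate_upto_coordinates:
  fixes n :: "complex \<times> complex \<Rightarrow> complex \<times> complex"
  defines "n \<equiv> \<lambda>x. x /\<^sub>R norm x"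
  shows "moderate_upto annulus m (\<lambda>k x. Re (fst (n x)))" "moderate_upto annulus m (\<lambda>k x. Im (fst (n x)))"
    "moderate_upto annulus m (\<lambda>k x. Re (snd (n x)))" "moderate_upto annulus m (\<lambda>k x. Im (snd (n x)))"
  using moderate_upto_inner_unit[of "\<lambda>_. (1, 0) :: complex \<times> complex" m]
    moderate_upto_inner_unit[of "\<lambda>_. (\<i>, 0) :: complex \<times> complex" m]
    moderate_upto_inner_unit[of "\<lambda>_. (0, 1) :: complex \<times> complex" m]
    moderate_upto_inner_unit[of "\<lambda>_. (0, \<i>) :: complex \<times> complex" m]
  by (simp_all add: n_def inner_prod_def norm_Pair inner_complex_def)

definition pole_dist2 :: "complex \<times> complex \<Rightarrow> real" where
  "pole_dist2 y = (1 - Re (snd y))\<^sup>2 + (Im (snd y))\<^sup>2"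

lemma pole_dist2_eq: "pole_dist2 y = (cmod (1 - snd y))\<^sup>2"
  by (simp add: pole_dist2_def cmod_power2)

lemma moderate_upto_pole_dist2:
  "moderate_upto annulus m (\<lambda>k x. pole_dist2 (x /\<^sub>R norm x))"
  unfolding pole_dist2_def power2_eq_square
  by (intro moderate_upto_add moderate_upto_mult moderate_upto_diff moderate_upto_constant open_annulus
      moderate_upto_coordinates)

lemma pole_dist2_le: "y \<in> S3 \<Longrightarrow> pole_dist2 y \<le> 4"
proof -
  assume "y \<in> S3"
  then have "cmod (snd y) \<le> 1"
    using norm_snd_le[of "snd y" "fst y"] by (simp add: S3_eq_sphere)
  then have "cmod (1 - snd y) \<le> 2" using norm_triangle_ineq4[of 1 "snd y"] by simp
  then show ?thesis unfolding pole_dist2_eq using power_mono[of _ 2 2] by fastforce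
qed

text \<open>A weight whose vanishing locus on the sphere is a given closed set; it is dominated by
  \<open>|1 - w|\<^sup>2\<close> so that inverse powers of it control the singularity of the phase at the pole.\<close>

lemma ex_weight:
  assumes "closed K" "K \<subseteq> S3" "(0, 1) \<in> K"
  obtains \<rho> :: "complex \<times> complex \<Rightarrow> real" where
    "\<And>m. moderate_upto annulus m (\<lambda>_ x. \<rho> (x /\<^sub>R norm x))"
    "\<And>y. y \<in> S3 \<Longrightarrow> 0 \<le> \<rho> y" "\<And>y. y \<in> S3 \<Longrightarrow> \<rho> y \<le> 1"
    "\<And>y. y \<in> S3 \<Longrightarrow> 4 * \<rho> y \<le> pole_dist2 y"
    "\<And>y. y \<in> S3 \<Longrightarrow> \<rho> y = 0 \<longleftrightarrow> y \<in> K"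
proof -
  obtain T where T: "countable T" "T \<subseteq> S3" "S3 \<subseteq> closure T"
    using separable[of S3] by metis
  have Tne: "T \<noteq> {}" using T(3) assms(2,3) by auto
  define a where "a = from_nat_into T"
  have aT: "a i \<in> S3" for i unfolding a_def by (rule subsetD[OF T(2) from_nat_into[OF Tne]])
  then have an: "norm (a i) = 1" for i by (auto simp: S3_eq_sphere)
  define r where "r i = infdist (a i) K" for i
  have r0: "r i \<ge> 0" for i by (simp add: r_def infdist_nonneg)
  have r2: "r i \<le> 2" for i
  proof -
    have "r i \<le> dist (a i) (0, 1)" unfolding r_def by (rule infdist_le[OF assms(3)])
    also have "\<dots> \<le> norm (a i) + norm (0::complex, 1::complex)" using norm_triangle_ineq4[of "a i" "(0, 1)"] by (simp add: dist_norm)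
    finally show ?thesis by (simp add: an norm_Pair)
  qed
  \<comment> \<open>On the sphere this is a bump that is positive exactly on the largest open ball
    around \<open>a i\<close> missing \<open>K\<close>. Written affinely in \<open>y\<close>, it is
    covered by \<open>moderate_upto_inner_unit\<close>.\<close>
  define \<psi> where "\<psi> i y = flat_exp ((r i)\<^sup>2 - 2 + 2 * (a i \<bullet> y))" for i y
  have \<psi>_eq: "\<psi> i y = flat_exp ((r i)\<^sup>2 - (dist y (a i))\<^sup>2)" if "y \<in> S3" for i y
  proof -
    have "(dist y (a i))\<^sup>2 = 2 - 2 * (a i \<bullet> y)"
      using that an[of i] dot_norm_neg[of y "a i"]
      by (simp add: dist_norm S3_eq_sphere inner_commute)
    then have "(r i)\<^sup>2 - 2 + 2 * (a i \<bullet> y) = (r i)\<^sup>2 - (dist y (a i))\<^sup>2" by linarith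
    then show ?thesis by (simp only: \<psi>_def)
  qed
  have \<psi>01: "0 \<le> \<psi> i y" "\<psi> i y \<le> 1" for i y
    by (simp_all add: \<psi>_def flat_exp_nonneg flat_exp_le_1)
  have mod_r: "moderate_upto annulus m (\<lambda>i x::complex \<times> complex. (r i)\<^sup>2)" for m
  proof (rule moderate_upto_const[of 4, OF _ _ open_annulus])
    fix i
    have "(r i)\<^sup>2 \<le> 2\<^sup>2" using r2[of i] r0[of i] by (intro power_mono)
    also have "\<dots> \<le> 4 ^ Suc i" using self_le_power[of 4 "Suc i"] by simp
    finally show "norm ((r i)\<^sup>2) \<le> 4 ^ Suc i" by simp
  qed simp
  have mod_\<psi>: "moderate_upto annulus m (\<lambda>i x. \<psi> i (x /\<^sub>R norm x))" for m
    unfolding \<psi>_def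
    by (intro moderate_upto_flat_exp moderate_upto_add moderate_upto_mult moderate_upto_diff
        moderate_upto_constant open_annulus moderate_upto_inner_unit mod_r) (simp add: an)
  define w where "w i = (1/2::real) ^ (i * i)" for i
  have w: "0 < w i" "w i \<le> (1/2) ^ i" for i
  proof -
    show "0 < w i" by (simp add: w_def)
    have "i \<le> i * i" by (cases i) auto
    then show "w i \<le> (1/2) ^ i" unfolding w_def by (intro power_decreasing) auto
  qed
  have geo: "summable (\<lambda>i. (1/2::real) ^ i)" by (simp add: summable_geometric)
  have sm: "summable (\<lambda>i. w i * \<psi> i y)" for y
  proof (rule summable_comparison_test'[OF geo, of 0])
    fix i
    show "norm (w i * \<psi> i y) \<le> (1/2) ^ i"
      using mult_mono[OF w(2)[of i] \<psi>01(2)[of i y]] w(1)[of i] \<psi>01(1)[of i y] by simp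
  qed
  define R where "R y = (\<Sum>i. w i * \<psi> i y)" for y
  have R0: "0 \<le> R y" for y
    unfolding R_def by (intro suminf_nonneg[OF sm] mult_nonneg_nonneg less_imp_le[OF w(1)] \<psi>01(1))
  have R2: "R y \<le> 2" for y
  proof -
    have "R y \<le> (\<Sum>i. (1/2::real) ^ i)" unfolding R_def
    proof (rule suminf_le[OF _ sm geo])
      show "w i * \<psi> i y \<le> (1/2) ^ i" for i
        using mult_mono[OF w(2)[of i] \<psi>01(2)[of i y]] \<psi>01(1)[of i y] by simp
    qed
    also have "\<dots> = 2" by (simp add: suminf_geometric)
    finally show ?thesis .
  qed
  have R_iff: "R y = 0 \<longleftrightarrow> y \<in> K" if y: "y \<in> S3" for y
  proof
    assume "R y = 0"
    moreover have "0 \<le> w i * \<psi> i y" for i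
      by (intro mult_nonneg_nonneg less_imp_le[OF w(1)] \<psi>01(1))
    ultimately have "w i * \<psi> i y = 0" for i
      using suminf_eq_zero_iff[OF sm[of y]] unfolding R_def by blast
    then have z: "\<psi> i y = 0" for i using w(1)[of i] by (metis mult_eq_0_iff less_irrefl)
    show "y \<in> K"
    proof (rule ccontr)
      assume nK: "y \<notin> K"
      have ne: "K \<noteq> {}" using assms by blast
      define d where "d = infdist y K"
      have d: "d > 0" unfolding d_def using infdist_pos_not_in_closed[OF assms(1) ne nK] .
      have "y \<in> closure T" using y T by blast
      then obtain t where t: "t \<in> T" "dist t y < d / 2"
        unfolding closure_approachable using half_gt_zero[OF d] by blast
      obtain i where i: "a i = t" unfolding a_def using from_nat_into_surj[OF T(1) t(1)] by blast
      have "d \<le> r i + dist y (a i)" unfolding d_def r_def by (rule infdist_triangle)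
      then have "dist y (a i) < r i" using t i by (simp add: dist_commute)
      then have "(dist y (a i))\<^sup>2 < (r i)\<^sup>2" by (intro power_strict_mono) auto
      then show False using z[of i] by (simp add: \<psi>_eq[OF y] flat_exp_eq_0_iff)
    qed
  next
    assume yK: "y \<in> K"
    have "\<psi> i y = 0" for i
    proof -
      have "r i \<le> dist (a i) y" unfolding r_def by (rule infdist_le[OF yK])
      then have "(r i)\<^sup>2 \<le> (dist y (a i))\<^sup>2" using r0 by (intro power_mono) (auto simp: dist_commute)
      then show ?thesis by (simp add: \<psi>_eq[OF y] flat_exp_eq_0_iff)
    qed
    then show "R y = 0" by (simp add: R_def)
  qed
  \<comment> \<open>Since \<open>R\<close> is at most 2 and \<open>pole_dist2\<close> at most 4, the
    factor 1/8 yields both the bound 1 and the domination by a quarter of \<open>pole_dist2\<close>.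
    The added zero is the pole, a point of \<open>K\<close>.\<close>
  define \<rho> where "\<rho> y = R y * pole_dist2 y * (1/8)" for y
  have D0: "0 \<le> pole_dist2 y" for y by (simp add: pole_dist2_def)
  show ?thesis
  proof (rule that[of \<rho>])
    fix m
    have "moderate_upto annulus m (\<lambda>_ x. R (x /\<^sub>R norm x))"
      using moderate_upto_weighted_series[OF open_annulus mod_\<psi>] by (simp add: R_def w_def)
    then show "moderate_upto annulus m (\<lambda>_ x. \<rho> (x /\<^sub>R norm x))"
      unfolding \<rho>_def
      by (intro moderate_upto_mult open_annulus moderate_upto_pole_dist2 moderate_upto_constant)
  next
    fix y assume y: "y \<in> S3"
    show "0 \<le> \<rho> y" by (simp add: \<rho>_def R0 D0)
    have le: "R y * pole_dist2 y \<le> 2 * pole_dist2 y" by (rule mult_right_mono[OF R2 D0])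
    show "4 * \<rho> y \<le> pole_dist2 y" using le unfolding \<rho>_def by linarith
    show "\<rho> y \<le> 1" using le pole_dist2_le[OF y] unfolding \<rho>_def by linarith
    have "pole_dist2 y = 0 \<Longrightarrow> y \<in> K"
    proof -
      assume "pole_dist2 y = 0"
      then have s: "snd y = 1" by (simp add: pole_dist2_eq)
      then have "fst y = 0" using y by (cases y) (simp add: S3_def)
      with s have "y = (0, 1)" by (simp add: prod_eq_iff)
      then show ?thesis using assms(3) by simp
    qed
    then show "\<rho> y = 0 \<longleftrightarrow> y \<in> K" using R_iff[OF y] by (auto simp: \<rho>_def)
  qed
qed

section \<open>The tangential Cauchy-Riemann operator\<close>

text \<open>The defect of complex linearity of the derivative on the complex tangent line of the sphere;
  up to a factor this is the tangential Cauchy-Riemann operator.\<close>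

definition tau :: "complex \<times> complex \<Rightarrow> complex \<times> complex" where
  "tau p = (- cnj (snd p), cnj (fst p))"

definition i_tau :: "complex \<times> complex \<Rightarrow> complex \<times> complex" where
  "i_tau p = (- \<i> * cnj (snd p), \<i> * cnj (fst p))"

definition cr :: "(complex \<times> complex \<Rightarrow> complex) \<Rightarrow> complex \<times> complex \<Rightarrow> complex" where
  "cr f p = frechet_derivative f (at p) (i_tau p) - \<i> * frechet_derivative f (at p) (tau p)"

lemma norm_tau: "p \<in> S3 \<Longrightarrow> norm (tau p) = 1"
  and norm_i_tau: "p \<in> S3 \<Longrightarrow> norm (i_tau p) = 1"
  by (auto simp: S3_def tau_def i_tau_def norm_Pair norm_mult power_mult_distrib add.commute)

lemma cr_eq: "(f has_derivative D) (at p) \<Longrightarrow> cr f p = D (i_tau p) - \<i> * D (tau p)"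
  by (simp add: cr_def frechet_derivative_at[symmetric])

lemma cr_const: "cr (\<lambda>x. c) p = 0"
  by (simp add: cr_eq[OF has_derivative_const])

lemma cr_add:
  assumes "f differentiable (at p)" "g differentiable (at p)"
  shows "cr (\<lambda>x. f x + g x) p = cr f p + cr g p"
  using cr_eq[OF has_derivative_add[OF assms[unfolded frechet_derivative_works]]]
  by (simp add: cr_def algebra_simps)

lemma cr_mult:
  assumes "f differentiable (at p)" "g differentiable (at p)"
  shows "cr (\<lambda>x. f x * g x) p = cr f p * g p + f p * cr g p"
  using cr_eq[OF has_derivative_mult[OF assms[unfolded frechet_derivative_works]]]
  by (simp add: cr_def algebra_simps)

lemma cr_chain:
  fixes F :: "complex \<times> complex \<Rightarrow> real"
  assumes "F differentiable (at p)" "(G has_vector_derivative G') (at (F p))"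
  shows "(\<lambda>x. G (F x)) differentiable (at p)"
    and "cr (\<lambda>x. G (F x)) p = G' * cr (\<lambda>x. complex_of_real (F x)) p"
proof -
  let ?D = "frechet_derivative F (at p)"
  have F: "(F has_derivative ?D) (at p)" using assms(1) frechet_derivative_works by blast
  have 1: "((\<lambda>x. G (F x)) has_derivative (\<lambda>v. ?D v *\<^sub>R G')) (at p)"
    using has_derivative_compose[OF F] assms(2) by (simp add: has_vector_derivative_def)
  then show "(\<lambda>x. G (F x)) differentiable (at p)" by (auto simp: differentiable_def)
  have 2: "((\<lambda>x. complex_of_real (F x)) has_derivative (\<lambda>v. complex_of_real (?D v))) (at p)"
    by (rule bounded_linear.has_derivative[OF bounded_linear_of_real F])
  show "cr (\<lambda>x. G (F x)) p = G' * cr (\<lambda>x. complex_of_real (F x)) p"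
    by (simp add: cr_eq[OF 1] cr_eq[OF 2] scaleR_conv_of_real algebra_simps)
qed

lemma cr_cong_open:
  assumes "open W" "p \<in> W" "\<And>y. y \<in> W \<Longrightarrow> f y = g y"
  shows "cr f p = cr g p"
  using frechet_derivative_cong_open[OF assms] by (simp add: cr_def)

text \<open>Used for the cutoffs, which take values in [0, 1]: wherever one equals 0 or 1 its
  derivative terms drop out, and no neighbourhood on which it is constant has to be found.\<close>

lemma cr_extremum:
  fixes F :: "complex \<times> complex \<Rightarrow> real"
  assumes "F differentiable (at p)" "open W" "p \<in> W"
    and "(\<forall>y\<in>W. F y \<le> F p) \<or> (\<forall>y\<in>W. F p \<le> F y)"
  shows "cr (\<lambda>x. complex_of_real (F x)) p = 0"
proof -
  have F: "(F has_derivative frechet_derivative F (at p)) (at p)"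
    using assms(1) frechet_derivative_works by blast
  have "((\<lambda>x. complex_of_real (F x)) has_derivative (\<lambda>v. complex_of_real 0)) (at p)"
    using bounded_linear.has_derivative[OF bounded_linear_of_real F]
      differential_zero_maxmin[OF assms(3,2) F assms(4)] by simp
  from cr_eq[OF this] show ?thesis by simp
qed

text \<open>A loop of mean zero that avoids the negative real axis: it can be shrunk through loops in the
  punctured plane by the linear homotopy to the constant 1. These are the two properties
  needed for convex integration.\<close>

definition loop :: "real \<Rightarrow> complex" where
  "loop s = complex_of_real (1 - 2 * (sin s)\<^sup>2) + \<i> * complex_of_real (sin s)"

text \<open>The existence of a periodic, hence bounded, antiderivative is where the vanishing mean
  of \<open>loop\<close> enters.\<close>

definition loop_primitive :: "real \<Rightarrow> complex" where
  "loop_primitive s = complex_of_real (sin s * cos s) - \<i> * complex_of_real (cos s)"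

definition loop_deriv :: "real \<Rightarrow> complex" where
  "loop_deriv s = complex_of_real (- 4 * sin s * cos s) + \<i> * complex_of_real (cos s)"

lemma loop_primitive_has_vector_derivative:
  "(loop_primitive has_vector_derivative loop s) (at s)"
proof -
  have "((\<lambda>s. sin s * cos s) has_real_derivative 1 - 2 * (sin s)\<^sup>2) (at s)"
    by (rule DERIV_cong, (rule derivative_intros)+)
      (use sin_cos_squared_add[of s] in \<open>simp add: power2_eq_square algebra_simps\<close>)
  moreover have "(cos has_real_derivative - sin s) (at s)" by (rule DERIV_cos)
  ultimately have "(loop_primitive has_vector_derivative
      complex_of_real (1 - 2 * (sin s)\<^sup>2) - \<i> * complex_of_real (- sin s)) (at s)"
    unfolding loop_primitive_def
    by (intro has_vector_derivative_diff has_vector_derivative_of_real has_vector_derivative_mult_right)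
  then show ?thesis by (simp add: loop_def)
qed

lemma loop_has_vector_derivative:
  "(loop has_vector_derivative loop_deriv s) (at s)"
proof -
  have "((\<lambda>s. 1 - 2 * (sin s)\<^sup>2) has_real_derivative - 4 * sin s * cos s) (at s)"
    by (auto intro!: derivative_eq_intros)
  moreover have "(sin has_real_derivative cos s) (at s)" by (rule DERIV_sin)
  ultimately show ?thesis
    unfolding loop_def loop_deriv_def
    by (intro has_vector_derivative_add has_vector_derivative_of_real has_vector_derivative_mult_right)
qed

lemma norm_loop_primitive_le: "cmod (loop_primitive s) \<le> 2"
proof -
  have "cmod (loop_primitive s) \<le> \<bar>sin s\<bar> * \<bar>cos s\<bar> + \<bar>cos s\<bar>"
    unfolding loop_primitive_def by (rule order_trans[OF norm_triangle_ineq4]) (simp add: norm_mult)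
  also have "\<bar>sin s\<bar> * \<bar>cos s\<bar> \<le> 1" by (rule mult_le_one) auto
  finally show ?thesis using abs_cos_le_one[of s] by linarith
qed

lemma norm_loop_deriv_le: "cmod (loop_deriv s) \<le> 5"
proof -
  have "cmod (loop_deriv s) \<le> \<bar>- 4 * sin s * cos s\<bar> + \<bar>cos s\<bar>"
    unfolding loop_deriv_def by (rule order_trans[OF norm_triangle_ineq]) (simp add: norm_mult)
  also have "\<bar>- 4 * sin s * cos s\<bar> = 4 * (\<bar>sin s\<bar> * \<bar>cos s\<bar>)" by (simp add: abs_mult)
  also have "\<bar>sin s\<bar> * \<bar>cos s\<bar> \<le> 1" by (rule mult_le_one) auto
  finally show ?thesis using abs_cos_le_one[of s] by linarith
qed

lemma norm_loop_le: "cmod (loop s) \<le> 2"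
proof -
  have "cmod (loop s) \<le> \<bar>1 - 2 * (sin s)\<^sup>2\<bar> + \<bar>sin s\<bar>"
    unfolding loop_def by (rule order_trans[OF norm_triangle_ineq]) (simp only: norm_mult norm_of_real, simp)
  moreover have "(sin s)\<^sup>2 \<le> 1" by (simp add: abs_square_le_1)
  moreover have "0 \<le> (sin s)\<^sup>2" by simp
  ultimately show ?thesis using abs_sin_le_one[of s] by linarith
qed

text \<open>If b (sin s)^2 is at most d/4, the real part a + b - 2 b (sin s)^2 is at least d/2.
  Otherwise the imaginary part has modulus b |sin s| >= b (sin s)^2 > d/4. No relation between
  \<open>a\<close> and \<open>b\<close> is involved.\<close>

lemma norm_loop_combination_ge:
  assumes "a \<ge> 0" "b \<ge> 0" "a + b \<ge> d" "d \<ge> 0"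
  shows "cmod (complex_of_real a + complex_of_real b * loop s) \<ge> d / 4"
proof -
  let ?c = "complex_of_real a + complex_of_real b * loop s"
  have re: "Re ?c = a + b - 2 * (b * (sin s)\<^sup>2)" by (simp add: loop_def algebra_simps)
  have im: "Im ?c = b * sin s" by (simp add: loop_def)
  show ?thesis
  proof (cases "b * (sin s)\<^sup>2 \<le> d / 4")
    case True
    then have "Re ?c \<ge> d / 2" using assms re by linarith
    then show ?thesis using complex_Re_le_cmod[of ?c] assms by linarith
  next
    case False
    have "(sin s)\<^sup>2 = \<bar>sin s\<bar> * \<bar>sin s\<bar>" by (simp add: power2_eq_square)
    also have "\<dots> \<le> \<bar>sin s\<bar>" using mult_left_mono[OF abs_sin_le_one[of s], of "\<bar>sin s\<bar>"] by simp
    finally have "b * (sin s)\<^sup>2 \<le> b * \<bar>sin s\<bar>" using assms by (intro mult_left_mono) auto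
    also have "\<dots> = \<bar>Im ?c\<bar>" unfolding im using assms by (simp add: abs_mult)
    finally show ?thesis using False abs_Im_le_cmod[of ?c] by linarith
  qed
qed

text \<open>If the derivative D of a function is complex linear on the line spanned by
  \<open>tau p\<close>, then \<open>cr\<close> of its real part is -i times the conjugate of D
  (\<open>tau p\<close>). For z / (1 - w) the latter derivative is the quotient under
  \<open>cnj\<close>.\<close>

definition pole_slope :: "complex \<times> complex \<Rightarrow> complex" where
  "pole_slope p = - \<i> * cnj ((1 - cnj (snd p)) / (1 - snd p)\<^sup>2)"

lemma norm_pole_slope_ge:
  assumes "p \<in> S3" "snd p \<noteq> 1"
  shows "cmod (pole_slope p) \<ge> 1 / 2"
proof -
  have "cmod (1 - cnj (snd p)) = cmod (1 - snd p)"
    using complex_mod_cnj[of "1 - snd p"] by simp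
  moreover have "cmod (1 - snd p) \<noteq> 0" using assms(2) by simp
  ultimately have "cmod (pole_slope p) = 1 / cmod (1 - snd p)"
    by (simp add: pole_slope_def norm_mult norm_divide norm_power power2_eq_square)
  moreover have "(cmod (1 - snd p))\<^sup>2 \<le> 2\<^sup>2"
    using pole_dist2_le[OF assms(1)] by (simp add: pole_dist2_eq)
  then have "cmod (1 - snd p) \<le> 2" by (rule power2_le_imp_le) simp
  ultimately show ?thesis using assms(2) frac_le[of 1 1 "cmod (1 - snd p)" 2] by simp
qed

text \<open>The real part of the function \<open>z / (1 - w)\<close>, which is holomorphic near the sphere minus
  the pole. The real part of a holomorphic function has horizontal gradient given by its derivative,
  so this phase has no horizontal critical point.\<close>

lemma cr_Re_holomorphic:
  assumes p: "p \<in> S3" and "snd p \<noteq> 1"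
  shows "cr (\<lambda>x. complex_of_real (Re (fst (sgn x) / (1 - snd (sgn x))))) p = pole_slope p"
proof -
  obtain z w where zw: "p = (z, w)" by (cases p)
  have np: "norm p = 1" using p by (simp add: S3_eq_sphere)
  then have p0: "p \<noteq> 0" by auto
  have w: "1 - w \<noteq> 0" using assms(2) zw by simp
  \<comment> \<open>Replacing 1 by the norm makes the quotient homogeneous of degree 0, so it
    extends the function on the sphere along rays without normalising \<open>x\<close>.\<close>
  let ?H = "\<lambda>x::complex\<times>complex. fst x / (complex_of_real (norm x) - snd x)"
  let ?D = "\<lambda>v. fst v / (1 - w) - z * (complex_of_real (v \<bullet> p) - snd v) / (1 - w)\<^sup>2"
  have norm': "((\<lambda>x. complex_of_real (norm x)) has_derivative (\<lambda>v. complex_of_real (v \<bullet> p))) (at p)"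
    using bounded_linear.has_derivative[OF bounded_linear_of_real has_derivative_norm[OF p0]] np
    by (simp add: sgn_div_norm inner_commute)
  have "(?H has_derivative ?D) (at p)"
  proof (rule has_derivative_eq_rhs[OF has_derivative_divide[OF has_derivative_fst[OF has_derivative_ident]
          has_derivative_diff[OF norm' has_derivative_snd[OF has_derivative_ident]]]])
    show "complex_of_real (norm p) - snd p \<noteq> 0" using w np zw by simp
    define e where "e = 1 - w"
    have e: "complex_of_real (norm p) - snd p = e" using np by (simp add: zw e_def)
    show "(\<lambda>v. - fst p * (inverse (complex_of_real (norm p) - snd p) * (complex_of_real (v \<bullet> p) - snd v) *
        inverse (complex_of_real (norm p) - snd p)) + fst v / (complex_of_real (norm p) - snd p)) = ?D"
      unfolding e unfolding e_def[symmetric]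
      by (simp add: fun_eq_iff zw divide_inverse power2_eq_square mult_ac)
  qed
  then have "((\<lambda>x. complex_of_real (Re (?H x))) has_derivative (\<lambda>v. complex_of_real (Re (?D v)))) (at p)"
    by (intro bounded_linear.has_derivative[OF bounded_linear_of_real]
        bounded_linear.has_derivative[OF bounded_linear_Re])
  from cr_eq[OF this]
  have 1: "cr (\<lambda>x. complex_of_real (Re (?H x))) p =
      complex_of_real (Re (?D (i_tau p))) - \<i> * complex_of_real (Re (?D (tau p)))" .
  define \<eta> where "\<eta> = (1 - cnj w) / (1 - w)\<^sup>2"
  have "complex_of_real ((cmod z)\<^sup>2 + (cmod w)\<^sup>2) = 1"
    using p zw by (simp add: S3_def del: of_real_add)
  then have zz: "z * cnj z + w * cnj w = 1" by (simp only: of_real_add complex_norm_square)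
  have orth: "tau p \<bullet> p = 0" "i_tau p \<bullet> p = 0"
    by (simp_all add: zw tau_def i_tau_def inner_prod_def inner_complex_def algebra_simps)
  have D: "?D (tau p) = \<eta>" 
  proof -
    have "?D (tau p) = (- cnj w * (1 - w) + z * cnj z) / (1 - w)\<^sup>2"
    proof -
      have "a / e - z * (complex_of_real 0 - c) / e\<^sup>2 = (a * e + z * c) / e\<^sup>2" if "e \<noteq> 0" for a c e
        using that by (simp add: field_simps power2_eq_square)
      from this[OF w] show ?thesis unfolding orth by (simp only: zw tau_def fst_conv snd_conv)
    qed
    \<comment> \<open>This is where |z|^2 + |w|^2 = 1 enters.\<close>
    also have "- cnj w * (1 - w) + z * cnj z = 1 - cnj w" using zz by (simp add: algebra_simps)
    finally show ?thesis by (simp add: \<eta>_def)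
  qed
  have Di: "?D (i_tau p) = \<i> * \<eta>"
  proof -
    have "?D (i_tau p) = \<i> * ?D (tau p)"
      unfolding orth by (simp add: zw tau_def i_tau_def algebra_simps)
    then show ?thesis by (simp add: D)
  qed
  have "cr (\<lambda>x. complex_of_real (Re (?H x))) p = pole_slope p"
    unfolding 1 D Di pole_slope_def by (simp add: zw \<eta>_def[symmetric] complex_eq_iff)
  moreover have "cr (\<lambda>x. complex_of_real (Re (?H x))) p =
      cr (\<lambda>x. complex_of_real (Re (fst (sgn x) / (1 - snd (sgn x))))) p"
  proof (rule cr_cong_open[of "- {0}"])
    fix x :: "complex \<times> complex" assume "x \<in> - {0}"
    then have x: "complex_of_real (norm x) \<noteq> 0" by simp
    have "fst (sgn x) / (1 - snd (sgn x)) = ?H x"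
      \<comment> \<open>On the ray through the pole both sides are quotients by 0, hence both
        0.\<close>
      using x by (cases "snd x = complex_of_real (norm x)")
        (auto simp: sgn_div_norm scaleR_conv_of_real field_simps)
    then show "complex_of_real (Re (?H x)) = complex_of_real (Re (fst (sgn x) / (1 - snd (sgn x))))"
      by simp
  qed (use p0 in auto)
  ultimately show ?thesis by simp
qed

section \<open>Convex integration\<close>

lemma moderate_upto_of_real:
  "open W \<Longrightarrow> moderate_upto W m F \<Longrightarrow> moderate_upto W m (\<lambda>k x. complex_of_real (F k x))"
  by (rule moderate_upto_bounded_linear[OF _ bounded_linear_of_real])

lemma moderate_upto_loop:
  assumes "open W" "moderate_upto W m F"
  shows "moderate_upto W m (\<lambda>k x. loop (F k x))"
    and "moderate_upto W m (\<lambda>k x. loop_primitive (F k x))"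
  unfolding loop_def loop_primitive_def power2_eq_square
  by (intro moderate_upto_add moderate_upto_mult moderate_upto_diff moderate_upto_constant
      moderate_upto_of_real moderate_upto_sin_cos assms)+

lemma moderate_upto_differentiable:
  "moderate_upto W (Suc m) F \<Longrightarrow> x \<in> W \<Longrightarrow> F k differentiable (at x)"
  by simp

lemma moderate_upto_exp_const:
  "open W \<Longrightarrow> c \<ge> 1 \<Longrightarrow> moderate_upto W m (\<lambda>k x. c ^ k :: real)"
  by (rule moderate_upto_const[of c]) (auto intro: power_increasing)

lemma sgn_idem:
  fixes x :: "'a::real_normed_vector"
  shows "sgn (sgn x) = sgn x"
  by (cases "x = 0") (simp_all add: sgn_div_norm)

text \<open>\<open>B\<close> stays a parameter because it has to exceed a constant extracted from
  the cutoffs, whose definition involves only \<open>\<rho>\<close>.\<close>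

locale corrugation =
  fixes \<rho> :: "complex \<times> complex \<Rightarrow> real" and B :: real
  assumes B1: "B \<ge> 1"
    and moderate_\<rho>: "\<And>m. moderate_upto annulus m (\<lambda>_ x. \<rho> (sgn x))"
    and \<rho>_nonneg: "\<And>y. y \<in> S3 \<Longrightarrow> 0 \<le> \<rho> y"
    and \<rho>_le_1: "\<And>y. y \<in> S3 \<Longrightarrow> \<rho> y \<le> 1"
    and \<rho>_le_pole: "\<And>y. y \<in> S3 \<Longrightarrow> 4 * \<rho> y \<le> pole_dist2 y"
begin

definition cutoff :: "nat \<Rightarrow> complex \<times> complex \<Rightarrow> real" where
  "cutoff k x = plateau (2 ^ k * \<rho> (sgn x) / 2)"

text \<open>The first factor is the real part of z times the conjugate of 1 - w. The second equals 1
  / |1 - w|^2 once 2^k |1 - w|^2 >= 1, and stays smooth across the pole with derivatives growing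
  only geometrically in \<open>k\<close>. So this is Re (z / (1 - w)) wherever shell
  \<open>k\<close> needs it.\<close>

definition phase :: "nat \<Rightarrow> complex \<times> complex \<Rightarrow> real" where
  "phase k x = (Re (fst (sgn x)) * (1 - Re (snd (sgn x))) - Im (fst (sgn x)) * Im (snd (sgn x))) *
     (2 ^ k * capped_inverse (2 ^ k * pole_dist2 (sgn x)))"

definition freq :: "nat \<Rightarrow> real" where
  "freq k = B ^ Suc k"

text \<open>The linear homotopy from the constant 1 to the loop, with the cutoff as homotopy
  parameter.\<close>

definition carrier_wave :: "nat \<Rightarrow> complex \<times> complex \<Rightarrow> complex" where
  "carrier_wave k x = 1 + complex_of_real (cutoff k x) * (loop (freq k * phase k x) - 1)"

text \<open>Layer \<open>k\<close> carries the oscillation of index \<open>k + 1\<close>. The factor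
  \<open>carrier_wave k\<close> continues the previous oscillation inside it until cutoff
  \<open>k\<close> has faded, and the first factor hands over to layer \<open>k + 1\<close>, which
  contains \<open>carrier_wave (k + 1)\<close>.\<close>

definition layer :: "nat \<Rightarrow> complex \<times> complex \<Rightarrow> complex" where
  "layer k x = complex_of_real (1 - cutoff (k + 2) x) * carrier_wave k x *
     complex_of_real (cutoff (k + 1) x) * loop_primitive (freq (k + 1) * phase (k + 1) x) *
     complex_of_real (inverse (freq (k + 1)))"

definition corrugated :: "complex \<times> complex \<Rightarrow> complex" where
  "corrugated x = (\<Sum>k. (1/2) ^ (k * k) *\<^sub>R layer k x)"

lemma freq_pos: "freq k > 0"
  using B1 by (simp add: freq_def)

lemma moderate_cutoff: "moderate_upto annulus m cutoff"
proof -
  have "moderate_upto annulus m (\<lambda>k x. plateau (2 ^ k * \<rho> (sgn x) * (1 / 2)))"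
    by (intro moderate_upto_plateau moderate_upto_mult moderate_upto_exp_const moderate_upto_constant
        open_annulus moderate_\<rho>) simp
  then show ?thesis by (simp add: cutoff_def[abs_def])
qed

lemma moderate_phase: "moderate_upto annulus m phase"
  unfolding phase_def[abs_def] sgn_div_norm
  by (intro moderate_upto_mult moderate_upto_diff moderate_upto_exp_const moderate_upto_constant
      moderate_upto_capped_inverse open_annulus moderate_upto_coordinates moderate_upto_pole_dist2)
    (auto simp: pole_dist2_eq)

lemma moderate_freq: "moderate_upto annulus m (\<lambda>k x. freq k)"
  by (rule moderate_upto_const[of B]) (use B1 open_annulus in \<open>auto simp: freq_def\<close>)

lemma moderate_inverse_freq: "moderate_upto annulus m (\<lambda>k x. inverse (freq k))"
proof (rule moderate_upto_const[of 1])
  show "norm (inverse (freq k)) \<le> 1 ^ Suc k" for k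
    using one_le_power[OF B1, of "Suc k"] by (simp add: freq_def inverse_eq_divide divide_le_eq)
qed (use open_annulus in auto)

lemma moderate_carrier_wave: "moderate_upto annulus m carrier_wave"
  unfolding carrier_wave_def[abs_def]
  by (intro moderate_upto_add moderate_upto_mult moderate_upto_diff moderate_upto_constant
      moderate_upto_of_real moderate_upto_loop moderate_freq moderate_phase moderate_cutoff open_annulus)

lemma moderate_layer: "moderate_upto annulus m layer"
proof -
  have s: "moderate_upto annulus m (\<lambda>k. F (k + 1))"
    if "moderate_upto annulus m F" for F :: "nat \<Rightarrow> complex \<times> complex \<Rightarrow> real"
    using moderate_upto_shift[OF that] by simp
  have "moderate_upto annulus m (\<lambda>k. cutoff (k + 2))"
    using s[OF s[OF moderate_cutoff]] by simp
  moreover have "moderate_upto annulus m (\<lambda>k. cutoff (k + 1))"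
    by (rule s[OF moderate_cutoff])
  moreover have "moderate_upto annulus m (\<lambda>k x. loop_primitive (freq (k + 1) * phase (k + 1) x))"
    using moderate_upto_loop(2)[OF open_annulus s[OF moderate_upto_mult[OF open_annulus moderate_freq moderate_phase]]]
    by simp
  moreover have "moderate_upto annulus m (\<lambda>k x::complex \<times> complex. inverse (freq (k + 1)))"
    using s[OF moderate_inverse_freq] by simp
  ultimately show ?thesis
    unfolding layer_def[abs_def]
    by (intro moderate_upto_mult moderate_upto_diff moderate_upto_constant moderate_upto_of_real
        moderate_carrier_wave open_annulus)
qed

lemma moderate_corrugated: "moderate_upto annulus m (\<lambda>_. corrugated)"
  unfolding corrugated_def[abs_def]
  by (rule moderate_upto_weighted_series[OF open_annulus moderate_layer])

lemma corrugated_sgn: "corrugated (sgn x) = corrugated x"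
  by (simp add: corrugated_def layer_def carrier_wave_def cutoff_def phase_def sgn_idem)

lemma sgn_S3: "p \<in> S3 \<Longrightarrow> sgn p = p"
  by (simp add: S3_eq_sphere sgn_div_norm)

lemma in_annulus: "p \<in> S3 \<Longrightarrow> p \<in> annulus"
  using S3_subset_annulus by blast

lemma isCont_\<rho>: "p \<in> annulus \<Longrightarrow> isCont (\<lambda>x. \<rho> (sgn x)) p"
  using moderate_upto_differentiable[OF moderate_\<rho>[of "Suc 0"]] differentiable_imp_continuous_within
  by blast

lemma open_\<rho>_set:
  assumes "open U"
  shows "open {x \<in> annulus. \<rho> (sgn x) \<in> U}"
proof -
  have "continuous_on annulus (\<lambda>x. \<rho> (sgn x))"
    using isCont_\<rho> by (intro continuous_at_imp_continuous_on) auto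
  then have "open ((\<lambda>x. \<rho> (sgn x)) -` U \<inter> annulus)"
    using continuous_on_open_vimage[OF open_annulus] assms by blast
  moreover have "(\<lambda>x. \<rho> (sgn x)) -` U \<inter> annulus = {x \<in> annulus. \<rho> (sgn x) \<in> U}" by auto
  ultimately show ?thesis by simp
qed

text \<open>Each layer vanishes on a neighbourhood of \<open>p\<close>. The neighbourhood shrinks
  with \<open>k\<close>, so the sum need not vanish near \<open>p\<close>, but all its derivatives
  at \<open>p\<close> may be taken termwise and every term is 0.\<close>

lemma corrugated_flat:
  assumes p: "p \<in> S3" "\<rho> p = 0"
  shows "iter_deriv vs corrugated p = 0"
proof -
  have "iter_deriv vs (layer k) p = 0" for k
  proof -
    let ?U = "{x \<in> annulus. \<rho> (sgn x) \<in> {..< (1/2) ^ k}}"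
    have "open ?U" by (rule open_\<rho>_set) simp
    moreover have "p \<in> ?U" using p in_annulus[OF p(1)] by (simp add: sgn_S3)
    moreover have "layer k x = 0" if "x \<in> ?U" for x
    proof -
      from that have "2 ^ k * \<rho> (sgn x) \<le> 2 ^ k * (1/2) ^ k" by (intro mult_left_mono) auto
      also have "\<dots> = (1::real)" by (simp add: power_mult_distrib[symmetric])
      finally have "2 ^ (k + 1) * \<rho> (sgn x) / 2 \<le> 1" by simp
      then show ?thesis using plateau_eq_0 by (simp add: layer_def cutoff_def)
    qed
    ultimately show ?thesis
      using iter_deriv_cong_open[of ?U p "layer k" "\<lambda>x. 0" vs] by (simp add: iter_deriv_zero)
  qed
  then show ?thesis
    using iter_deriv_weighted_series[OF open_annulus moderate_layer in_annulus[OF p(1)], of vs]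
    by (simp add: corrugated_def[abs_def])
qed

lemma cr_corrugated_zero:
  assumes "p \<in> S3" "\<rho> p = 0"
  shows "cr corrugated p = 0"
  using corrugated_flat[OF assms, of "[tau p]"] corrugated_flat[OF assms, of "[i_tau p]"]
  by (simp add: cr_def)

lemma sums_cr_corrugated:
  assumes "p \<in> S3"
  shows "(\<lambda>k. (1/2) ^ (k * k) *\<^sub>R cr (layer k) p) sums cr corrugated p"
proof -
  let ?D = "\<lambda>v k. (1/2) ^ (k * k) *\<^sub>R frechet_derivative (layer k) (at p) v"
  note p = in_annulus[OF assms]
  have "moderate_upto annulus 0 (\<lambda>k x. frechet_derivative (layer k) (at x) v)" for v
    using moderate_layer[of "Suc 0"] unfolding moderate_upto.simps(2)[of _ 0] by blast
  from weighted_series_abs[OF this p] have s: "?D v sums (\<Sum>k. ?D v k)" for v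
    by (rule summable_sums[OF summable_norm_cancel])
  have "cr corrugated p = (\<Sum>k. ?D (i_tau p) k) - \<i> * (\<Sum>k. ?D (tau p) k)"
    unfolding corrugated_def[abs_def]
    by (rule cr_eq[OF has_derivative_weighted_series[OF open_annulus moderate_layer p]])
  moreover have "(\<lambda>k. ?D (i_tau p) k - \<i> * ?D (tau p) k) sums
      ((\<Sum>k. ?D (i_tau p) k) - \<i> * (\<Sum>k. ?D (tau p) k))"
    by (intro sums_diff sums_mult s)
  moreover have "(\<lambda>k. (1/2) ^ (k * k) *\<^sub>R cr (layer k) p) = (\<lambda>k. ?D (i_tau p) k - \<i> * ?D (tau p) k)"
    by (simp add: cr_def fun_eq_iff scaleR_diff_right)
  ultimately show ?thesis by (simp only:)
qed

section \<open>The operator on cutoffs, phases and layers\<close>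

lemma cutoff_nonneg: "0 \<le> cutoff k x" and cutoff_le_1: "cutoff k x \<le> 1"
  by (simp_all add: cutoff_def plateau_nonneg plateau_le_1)

abbreviation d_cutoff :: "nat \<Rightarrow> complex \<times> complex \<Rightarrow> complex" where
  "d_cutoff k \<equiv> cr (\<lambda>x. complex_of_real (cutoff k x))"

abbreviation d_phase :: "nat \<Rightarrow> complex \<times> complex \<Rightarrow> complex" where
  "d_phase k \<equiv> cr (\<lambda>x. complex_of_real (phase k x))"

lemma differentiable_cutoff: "p \<in> S3 \<Longrightarrow> cutoff k differentiable (at p)"
  and differentiable_phase: "p \<in> S3 \<Longrightarrow> phase k differentiable (at p)"
  and differentiable_carrier_wave: "p \<in> S3 \<Longrightarrow> carrier_wave k differentiable (at p)"
  by (intro moderate_upto_differentiable[OF moderate_cutoff[of "Suc 0"]]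
      moderate_upto_differentiable[OF moderate_phase[of "Suc 0"]]
      moderate_upto_differentiable[OF moderate_carrier_wave[of "Suc 0"]] in_annulus; assumption)+

lemma d_cutoff_0:
  assumes "p \<in> S3" "cutoff k p = 0 \<or> cutoff k p = 1"
  shows "d_cutoff k p = 0"
  by (rule cr_extremum[OF differentiable_cutoff[OF assms(1)], of UNIV])
    (use assms(2) cutoff_nonneg cutoff_le_1 in auto)

text \<open>The domination of \<open>\<rho>\<close> by \<open>pole_dist2\<close> makes the cap in
  \<open>capped_inverse\<close> inactive near \<open>p\<close>, leaving the real part of the
  holomorphic function.\<close>

lemma d_phase_eq:
  assumes p: "p \<in> S3" and "\<rho> p > (1/2) ^ k"
  shows "d_phase k p = pole_slope p"
proof -
  let ?U = "{x \<in> annulus. \<rho> (sgn x) \<in> {(1/2) ^ k <..}}"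
  have "pole_dist2 p > 0"
    using \<rho>_le_pole[OF p] assms(2) zero_less_power[of "1/2 :: real" k] by linarith
  then have "snd p \<noteq> 1" by (auto simp: pole_dist2_def)
  have "d_phase k p = cr (\<lambda>x. complex_of_real (Re (fst (sgn x) / (1 - snd (sgn x))))) p"
  proof (rule cr_cong_open[of ?U])
    show "open ?U" by (rule open_\<rho>_set) simp
    show "p \<in> ?U" using assms in_annulus[OF p] by (simp add: sgn_S3)
    fix x assume x: "x \<in> ?U"
    define y where "y = sgn x"
    have "x \<noteq> 0" using x by (auto simp: annulus_def)
    then have y: "y \<in> S3" by (simp add: y_def S3_eq_sphere norm_sgn)
    have "2 ^ k * (1/2) ^ k \<le> 2 ^ k * pole_dist2 y"
      using \<rho>_le_pole[OF y] \<rho>_nonneg[OF y] x by (intro mult_left_mono) (auto simp: y_def)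
    then have "2 ^ k * pole_dist2 y \<ge> 1" by (simp add: power_mult_distrib[symmetric])
    then have "2 ^ k * capped_inverse (2 ^ k * pole_dist2 y) = inverse (pole_dist2 y)"
      by (simp add: capped_inverse_eq)
    then have "phase k x = (Re (fst y) * (1 - Re (snd y)) - Im (fst y) * Im (snd y)) / pole_dist2 y"
      by (simp add: phase_def y_def[symmetric] divide_inverse)
    also have "\<dots> = Re (fst y / (1 - snd y))"
      by (simp add: Re_divide pole_dist2_def)
    finally show "complex_of_real (phase k x) =
        complex_of_real (Re (fst (sgn x) / (1 - snd (sgn x))))"
      by (simp add: y_def)
  qed
  also have "\<dots> = pole_slope p" by (rule cr_Re_holomorphic) fact+
  finally show ?thesis .
qed

lemma cr_wave:
  assumes p: "p \<in> S3" and G: "\<And>s. (G has_vector_derivative G' s) (at s)"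
  shows "(\<lambda>x. G (freq k * phase k x)) differentiable (at p)"
    "cr (\<lambda>x. G (freq k * phase k x)) p = G' (freq k * phase k p) * (of_real (freq k) * d_phase k p)"
proof -
  have d: "(\<lambda>x. freq k * phase k x) differentiable (at p)"
    by (intro differentiable_mult differentiable_const differentiable_phase p)
  have r: "(\<lambda>x. complex_of_real (phase k x)) differentiable (at p)"
    using moderate_upto_differentiable[OF moderate_upto_of_real[OF open_annulus moderate_phase[of "Suc 0"]]]
      in_annulus[OF p] by blast
  show "(\<lambda>x. G (freq k * phase k x)) differentiable (at p)"
    by (rule cr_chain(1)[OF d G])
  have "cr (\<lambda>x. complex_of_real (freq k * phase k x)) p = of_real (freq k) * d_phase k p"
    using cr_mult[OF differentiable_const r, of "of_real (freq k)"] by (simp add: cr_const)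
  then show "cr (\<lambda>x. G (freq k * phase k x)) p = G' (freq k * phase k p) * (of_real (freq k) * d_phase k p)"
    using cr_chain(2)[OF d G] by simp
qed

lemma differentiable_of_real_cutoff:
  "p \<in> S3 \<Longrightarrow> (\<lambda>x. complex_of_real (cutoff k x)) differentiable (at p)"
  using moderate_upto_differentiable[OF moderate_upto_of_real[OF open_annulus moderate_cutoff[of "Suc 0"]]]
    in_annulus by blast

lemma cr_carrier_wave:
  assumes p: "p \<in> S3"
  shows "cr (carrier_wave k) p = d_cutoff k p * (loop (freq k * phase k p) - 1) +
    of_real (cutoff k p) * (loop_deriv (freq k * phase k p) * (of_real (freq k) * d_phase k p))"
proof -
  let ?l = "\<lambda>x. loop (freq k * phase k x)"
  note w = cr_wave[OF p loop_has_vector_derivative, of k]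
  have d: "(\<lambda>x. ?l x + (- 1)) differentiable (at p)"
    by (intro differentiable_add differentiable_const w)
  have "cr (\<lambda>x. ?l x + (- 1)) p = cr ?l p"
    by (subst cr_add[OF w(1) differentiable_const]) (simp only: cr_const, simp)
  then have "cr (\<lambda>x. of_real (cutoff k x) * (?l x + (- 1))) p =
      d_cutoff k p * (?l p - 1) + of_real (cutoff k p) * cr ?l p"
    by (subst cr_mult[OF differentiable_of_real_cutoff[OF p] d]) simp
  moreover have "cr (carrier_wave k) p = cr (\<lambda>x. of_real (cutoff k x) * (?l x + (- 1))) p"
    using cr_add[OF differentiable_const differentiable_mult[OF differentiable_of_real_cutoff[OF p] d], of 1 k]
    by (simp add: cr_const carrier_wave_def[abs_def])
  ultimately show ?thesis by (simp add: w(2))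
qed

text \<open>Only the derivative of the oscillating factor produces the frequency, which cancels the
  normalisation and leaves the last summand. Everything else is divided by
  \<open>freq (k + 1)\<close> and will be an error.\<close>

lemma cr_layer:
  fixes k p
  assumes p: "p \<in> S3"
  defines "\<theta> \<equiv> freq (k + 1) * phase (k + 1) p"
  shows "cr (layer k) p =
    (((1 - of_real (cutoff (k + 2) p)) * cr (carrier_wave k) p - d_cutoff (k + 2) p * carrier_wave k p) *
        of_real (cutoff (k + 1) p) +
      (1 - of_real (cutoff (k + 2) p)) * carrier_wave k p * d_cutoff (k + 1) p) *
      loop_primitive \<theta> / of_real (freq (k + 1)) +
    (1 - of_real (cutoff (k + 2) p)) * carrier_wave k p * of_real (cutoff (k + 1) p) * loop \<theta> *
      d_phase (k + 1) p"
proof -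
  let ?u = "\<lambda>x. 1 + (- 1) * complex_of_real (cutoff (k + 2) x)"
  let ?v = "\<lambda>x. complex_of_real (cutoff (k + 1) x)"
  let ?P = "\<lambda>x. loop_primitive (freq (k + 1) * phase (k + 1) x)"
  note c = differentiable_of_real_cutoff[OF p]
  have u': "(\<lambda>x. (- 1) * complex_of_real (cutoff (k + 2) x)) differentiable (at p)"
    by (intro differentiable_mult differentiable_const c)
  have u: "?u differentiable (at p)" by (intro differentiable_add differentiable_const u')
  have cu: "cr ?u p = - d_cutoff (k + 2) p"
    by (subst cr_add[OF differentiable_const u'], subst cr_mult[OF differentiable_const c])
      (simp add: cr_const)
  note g = differentiable_carrier_wave[OF p, of k]
  note P = cr_wave[OF p loop_primitive_has_vector_derivative, of "k + 1"]
  have "cr (layer k) p = cr (\<lambda>x. ?u x * carrier_wave k x * ?v x * ?P x * of_real (inverse (freq (k + 1)))) p"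
    by (simp add: layer_def[abs_def])
  also have "\<dots> = (((cr ?u p * carrier_wave k p + ?u p * cr (carrier_wave k) p) * ?v p +
      ?u p * carrier_wave k p * d_cutoff (k + 1) p) * ?P p +
      ?u p * carrier_wave k p * ?v p * cr ?P p) * of_real (inverse (freq (k + 1)))"
    by (simp only: cr_mult[OF differentiable_mult[OF differentiable_mult[OF differentiable_mult[OF u g] c] P(1)]
          differentiable_const] cr_mult[OF differentiable_mult[OF differentiable_mult[OF u g] c] P(1)]
          cr_mult[OF differentiable_mult[OF u g] c] cr_mult[OF u g] cr_const mult_zero_right add_0_right)
  also have "\<dots> = (((- d_cutoff (k + 2) p * carrier_wave k p + ?u p * cr (carrier_wave k) p) * ?v p +
      ?u p * carrier_wave k p * d_cutoff (k + 1) p) * ?P p / of_real (freq (k + 1)) +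
      ?u p * carrier_wave k p * ?v p * loop \<theta> * d_phase (k + 1) p)"
    using freq_pos[of "k + 1"] unfolding cu P(2) \<theta>_def
    by (simp add: field_simps)
  finally show ?thesis by (simp add: \<theta>_def algebra_simps)
qed

lemma norm_d_cutoff_bound:
  obtains C where "C \<ge> 1" "\<And>k p. p \<in> S3 \<Longrightarrow> cmod (d_cutoff k p) \<le> C ^ Suc k"
proof -
  obtain L where L: "L \<ge> 1" "\<And>k x v. x \<in> annulus \<Longrightarrow>
      norm (frechet_derivative (cutoff k) (at x) v) \<le> L ^ Suc k * norm v"
    using moderate_upto_frechet_bound[OF moderate_cutoff[of "Suc 0"]] by metis
  show ?thesis
  proof (rule that)
    show "2 * L \<ge> 1" using L(1) by simp
    fix k p assume p: "p \<in> S3"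
    let ?D = "frechet_derivative (cutoff k) (at p)"
    have "(cutoff k has_derivative ?D) (at p)"
      using differentiable_cutoff[OF p] frechet_derivative_works by blast
    from cr_eq[OF bounded_linear.has_derivative[OF bounded_linear_of_real this]]
    have "cmod (d_cutoff k p) = cmod (complex_of_real (?D (i_tau p)) - \<i> * complex_of_real (?D (tau p)))"
      by simp
    also have "\<dots> \<le> \<bar>?D (i_tau p)\<bar> + \<bar>?D (tau p)\<bar>"
      by (rule order_trans[OF norm_triangle_ineq4]) (simp add: norm_mult)
    also have "\<dots> \<le> 2 * L ^ Suc k"
      using L(2)[OF in_annulus[OF p], of k "i_tau p"] L(2)[OF in_annulus[OF p], of k "tau p"]
      by (simp add: norm_tau[OF p] norm_i_tau[OF p])
    also have "\<dots> \<le> (2 * L) ^ Suc k"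
      using mult_right_mono[OF self_le_power[of "2::real" "Suc k"], of "L ^ Suc k"] L(1)
      by (simp add: power_mult_distrib)
    finally show "cmod (d_cutoff k p) \<le> (2 * L) ^ Suc k" .
  qed
qed

lemma cr_corrugated_nonzero:
  assumes C: "C \<ge> 1" "\<And>k p. p \<in> S3 \<Longrightarrow> cmod (d_cutoff k p) \<le> C ^ Suc k"
    and B: "B \<ge> 1000 * C\<^sup>2" and p: "p \<in> S3" "\<rho> p > 0"
  shows "cr corrugated p \<noteq> 0"
proof -
  have CC: "C \<le> C\<^sup>2" "1 \<le> C\<^sup>2" using C(1) by (auto simp: self_le_power one_le_power)
  have Bpos: "B > 0" using B1 by simp
  have CB: "C / B \<le> 1 / 1000" "C\<^sup>2 / B \<le> 1 / 1000" "4 * C / B \<le> 1" "1 / B \<le> 1 / 1000" "C / B \<ge> 0"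
    using B CC Bpos C(1) by (simp_all add: divide_le_eq)
  define u where "u k = 2 ^ k * \<rho> p / 2" for k :: nat
  have cu: "cutoff k p = plateau (u k)" for k by (simp add: cutoff_def u_def sgn_S3[OF p(1)])
  have uS: "u (Suc k) = 2 * u k" for k by (simp add: u_def)
  have umono: "u k \<le> u l" if "k \<le> l" for k l
    unfolding u_def using that p(2) by (intro divide_right_mono mult_right_mono power_increasing) auto
  have d0: "d_cutoff k p = 0" if "cutoff k p = 0 \<or> cutoff k p = 1" for k
    by (rule d_cutoff_0[OF p(1) that])
  have ex: "\<exists>k. u k \<ge> 3 / 2"
  proof -
    obtain k where "3 / \<rho> p < 2 ^ k" using real_arch_pow[of 2 "3 / \<rho> p"] by auto
    then show ?thesis using p(2) by (intro exI[of _ k]) (simp add: u_def field_simps)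
  qed
  \<comment> \<open>By minimality and doubling, \<open>u j\<close> lies in [3/2, 3), so cutoff
    \<open>j\<close> equals 1 at \<open>p\<close>.\<close>
  define j where "j = (LEAST k. u k \<ge> 3 / 2)"
  have uj: "u j \<ge> 3 / 2" unfolding j_def by (rule LeastI_ex[OF ex])
  have "j \<noteq> 0"
  proof
    assume "j = 0"
    then have "3 / 2 \<le> \<rho> p / 2" using uj by (simp add: u_def)
    then show False using \<rho>_le_1[OF p(1)] by simp
  qed
  then obtain i where ji: "j = Suc i" by (cases j) auto
  have ui: "u i < 3 / 2" using not_less_Least[of i "\<lambda>k. u k \<ge> 3 / 2"] ji unfolding j_def[symmetric] by simp
  have uj3: "u j < 3" using ui uS[of i] ji by simp
  have cj: "cutoff j p = 1" unfolding cu by (rule plateau_eq_1) (use uj uj3 in auto)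
  have hi: "cutoff k p = 0" if "k \<ge> j + 2" for k
    using umono[OF that] uS[of j] uS[of "Suc j"] uj unfolding cu by (intro plateau_eq_0) simp
  have lo: "cutoff k p = 0" if "k < i" for k
    using umono[of "Suc k" i] uS[of k] ui that unfolding cu by (intro plateau_eq_0) simp
  \<comment> \<open>Layer \<open>j - 2\<close> is killed by its factor 1 - cutoff \<open>j\<close>,
    the others by the cutoff of index \<open>k + 1\<close>. The derivative of that cutoff vanishes
    as well, so the derivative of the whole layer does.\<close>
  have layer0: "cr (layer k) p = 0" if k: "k \<noteq> i" "k \<noteq> j" for k
  proof -
    consider "k + 2 = j" | "k + 1 < i" | "k + 1 \<ge> j + 2" using k ji by linarith
    then show ?thesis
    proof cases
      case 1
      then have "cutoff (k + 2) p = 1" "d_cutoff (k + 2) p = 0" using cj d0[of j] by simp_all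
      then show ?thesis unfolding cr_layer[OF p(1)] by simp
    next
      case 2
      then have "cutoff (k + 1) p = 0" "d_cutoff (k + 1) p = 0" using lo d0[of "k + 1"] by simp_all
      then show ?thesis unfolding cr_layer[OF p(1)] by simp
    next
      case 3
      then have "cutoff (k + 1) p = 0" "d_cutoff (k + 1) p = 0" using hi d0[of "k + 1"] by simp_all
      then show ?thesis unfolding cr_layer[OF p(1)] by simp
    qed
  qed
  have "(\<lambda>k. (1/2) ^ (k * k) *\<^sub>R cr (layer k) p) sums
      (\<Sum>k\<in>{i, j}. (1/2) ^ (k * k) *\<^sub>R cr (layer k) p)"
    by (rule sums_finite) (use layer0 in auto)
  from sums_unique2[OF sums_cr_corrugated[OF p(1)] this]
  have total: "cr corrugated p = (1/2) ^ (i * i) *\<^sub>R cr (layer i) p + (1/2) ^ (j * j) *\<^sub>R cr (layer j) p"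
    using ji by simp
  define c where "c = pole_slope p"
  have ph: "d_phase k p = c" if "k \<ge> i" for k
  proof -
    have "u k \<ge> 3 / 4" using umono[OF that] uS[of i] uj ji by simp
    then have "2 ^ k * \<rho> p > 1" by (simp add: u_def)
    then have "\<rho> p > (1/2) ^ k" by (simp add: power_divide field_simps)
    from d_phase_eq[OF p(1) this] show ?thesis by (simp add: c_def)
  qed
  have "snd p \<noteq> 1"
    using \<rho>_le_pole[OF p(1)] p(2) by (auto simp: pole_dist2_def)
  then have c: "cmod c \<ge> 1 / 2" unfolding c_def by (rule norm_pole_slope_ge[OF p(1)])
  have wave_ge: "cmod (carrier_wave k p) \<ge> 1 / 4" for k
  proof -
    have "carrier_wave k p = complex_of_real (1 - cutoff k p) +
        complex_of_real (cutoff k p) * loop (freq k * phase k p)"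
      by (simp add: carrier_wave_def algebra_simps)
    then show ?thesis
      using norm_loop_combination_ge[of "1 - cutoff k p" "cutoff k p" 1 "freq k * phase k p"]
        cutoff_nonneg[of k p] cutoff_le_1[of k p] by simp
  qed
  have loop_ge: "cmod (loop s) \<ge> 1 / 4" for s
    using norm_loop_combination_ge[of 0 1 1 s] by simp
  have freqS: "freq (Suc k) = B * freq k" for k by (simp add: freq_def)
  let ?\<theta> = "\<lambda>k. freq k * phase k p"
  have norm_P: "cmod (X * loop_primitive s / of_real (freq k)) \<le> A * 2 / freq k"
    if "cmod X \<le> A" for X A s k
  proof -
    have "cmod (X * loop_primitive s) \<le> A * 2"
      unfolding norm_mult using that norm_loop_primitive_le[of s]
      by (intro mult_mono) (auto intro: order_trans[OF norm_ge_zero])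
    then show ?thesis
      using freq_pos[of k] by (simp add: norm_divide divide_right_mono)
  qed
  show ?thesis
  proof (cases "u j \<ge> 2")
    \<comment> \<open>Here cutoff \<open>j + 1\<close> is 0 and only cutoff \<open>i\<close> may be
      partial: layer \<open>i\<close> alone contributes, with leading term carrier times loop times
      slope, of modulus at least |c| / 16.\<close>
    case True
    have cS: "cutoff (j + 1) p = 0" "cutoff (i + 2) p = 0"
      using True uS[of j] ji unfolding cu by (auto intro!: plateau_eq_0)
    have dS: "d_cutoff (j + 1) p = 0" "d_cutoff (i + 2) p = 0" using d0 cS by simp_all
    have lj: "cr (layer j) p = 0" unfolding cr_layer[OF p(1)] cS dS by simp
    have cj': "cutoff (i + 1) p = 1" "d_cutoff (i + 1) p = 0" using cj d0[of j] ji by simp_all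
    define err where "err = cr (carrier_wave i) p * loop_primitive (?\<theta> (i + 1)) / of_real (freq (i + 1))"
    have li: "cr (layer i) p = err + carrier_wave i p * loop (?\<theta> (i + 1)) * c"
      unfolding cr_layer[OF p(1)] cS dS cj' err_def using ph[of "i + 1"] by simp
    have "cmod (cr (carrier_wave i) p) \<le> C ^ Suc i * 3 + 1 * (5 * (freq i * cmod c))"
      unfolding cr_carrier_wave[OF p(1)]
    proof (rule norm_triangle_le[OF add_mono])
      have "cmod (loop (?\<theta> i) - 1) \<le> 3"
        using norm_triangle_ineq4[of "loop (?\<theta> i)" 1] norm_loop_le[of "?\<theta> i"] by simp
      then show "cmod (d_cutoff i p * (loop (?\<theta> i) - 1)) \<le> C ^ Suc i * 3"
        unfolding norm_mult using C by (intro mult_mono C(2)[OF p(1)]) auto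
      show "cmod (of_real (cutoff i p) * (loop_deriv (?\<theta> i) * (of_real (freq i) * d_phase i p))) \<le>
          1 * (5 * (freq i * cmod c))"
        unfolding norm_mult ph[OF order_refl]
        using norm_loop_deriv_le[of "?\<theta> i"] cutoff_nonneg[of i p] cutoff_le_1[of i p] freq_pos[of i]
        by (intro mult_mono) auto
    qed
    then have "cmod err \<le> (C ^ Suc i * 3 + 5 * (freq i * cmod c)) * 2 / freq (i + 1)"
      unfolding err_def by (intro norm_P) simp
    also have "\<dots> = (6 * (C / B) ^ Suc i + 10 * cmod c) / B"
      using Bpos by (simp add: freq_def field_simps power_divide)
    also have "\<dots> \<le> (6 * 1 + 10 * cmod c) / B"
      using Bpos CB by (intro divide_right_mono add_mono mult_left_mono power_le_one) auto
    \<comment> \<open>The term 6 is absorbed into 12 |c|, as |c| >= 1/2; afterwards 22/1000 <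
      1/16.\<close>
    also have "\<dots> \<le> 22 * cmod c * (1 / B)"
      using c Bpos by (simp add: divide_right_mono)
    also have "\<dots> \<le> 22 * cmod c * (1 / 1000)"
      using CB(4) by (intro mult_left_mono) auto
    finally have err: "cmod err < cmod c / 16" using c by simp
    have "1 / 4 * (1 / 4) * cmod c \<le> cmod (carrier_wave i p) * cmod (loop (?\<theta> (i + 1))) * cmod c"
      by (intro mult_mono wave_ge loop_ge mult_nonneg_nonneg) auto
    then have "cmod err < cmod (carrier_wave i p * loop (?\<theta> (i + 1)) * c)"
      using err unfolding norm_mult by linarith
    then have "cr (layer i) p \<noteq> 0"
      unfolding li by (metis add_eq_0_iff norm_minus_cancel order_less_irrefl)
    then show ?thesis unfolding total lj by simp
  next
    \<comment> \<open>Now cutoff \<open>i\<close> is 0 and cutoff \<open>j + 1\<close> may be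
      partial, so layers \<open>i\<close> and \<open>j\<close> both contribute, with the loop of
      index \<open>j\<close> as a common factor.\<close>
    case False
    have ci: "cutoff i p = 0" using False uS[of i] ji unfolding cu by (intro plateau_eq_0) simp
    define s where "s = cutoff (j + 1) p"
    have s01: "0 \<le> s" "s \<le> 1" unfolding s_def by (rule cutoff_nonneg cutoff_le_1)+
    define ds where "ds = d_cutoff (j + 1) p"
    have s2: "cutoff (i + 2) p = s" "d_cutoff (i + 2) p = ds" by (simp_all add: s_def ds_def ji)
    have ds: "cmod ds \<le> C ^ (j + 2)" using C(2)[OF p(1), of "j + 1"] by (simp add: ds_def)
    have cj': "cutoff (i + 1) p = 1" "d_cutoff (i + 1) p = 0" "d_cutoff j p = 0" "d_cutoff i p = 0"
      using cj d0[of j] d0[of i] ci ji by simp_all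
    have c2: "cutoff (j + 2) p = 0" "d_cutoff (j + 2) p = 0" using hi d0[of "j + 2"] by simp_all
    have wi: "carrier_wave i p = 1" "cr (carrier_wave i) p = 0"
      using ci cj' by (simp_all add: carrier_wave_def cr_carrier_wave[OF p(1)])
    have wj: "carrier_wave j p = loop (?\<theta> j)"
        "cr (carrier_wave j) p = loop_deriv (?\<theta> j) * (of_real (freq j) * c)"
      using cj cj' ph[of j] ji by (simp_all add: carrier_wave_def cr_carrier_wave[OF p(1)])
    define err1 where "err1 = (- ds) * loop_primitive (?\<theta> j) / of_real (freq j)"
    define err2 where "err2 = (loop_deriv (?\<theta> j) * (of_real (freq j) * c) * of_real s + loop (?\<theta> j) * ds) *
        loop_primitive (?\<theta> (j + 1)) / of_real (freq (j + 1))"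
    have li: "cr (layer i) p = err1 + (1 - of_real s) * loop (?\<theta> j) * c"
      unfolding cr_layer[OF p(1)] s2 cj' wi err1_def using ph[of "i + 1"] by (simp add: ji)
    have lj: "cr (layer j) p = err2 + loop (?\<theta> j) * of_real s * loop (?\<theta> (j + 1)) * c"
      unfolding cr_layer[OF p(1)] c2 wj s_def[symmetric] ds_def[symmetric] err2_def
      using ph[of "j + 1"] ji by simp
    \<comment> \<open>The ratio of the two amplitudes. It is not bounded in \<open>j\<close>, but
      only \<open>r \<ge> 1\<close> matters for the main term: the weights
      \<open>r * (1 - s)\<close> and \<open>s\<close> add up to at least 1.\<close>
    define r :: real where "r = 2 ^ (2 * i + 1)"
    have r1: "r \<ge> 1" unfolding r_def by (rule one_le_power) simp
    have jj: "j * j = i * i + (2 * i + 1)" by (simp add: ji)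
    have w: "(1/2::real) ^ (i * i) = (1/2) ^ (j * j) * r"
      unfolding jj r_def power_add by (simp add: power_divide)
    define main where "main = loop (?\<theta> j) * (of_real (r * (1 - s)) + of_real s * loop (?\<theta> (j + 1))) * c"
    have tot: "cr corrugated p = (1/2) ^ (j * j) *\<^sub>R (main + (of_real r * err1 + err2))"
      unfolding total w li lj main_def by (simp add: scaleR_conv_of_real algebra_simps)
    have "r * (1 - s) \<ge> 1 - s" using mult_right_mono[OF r1, of "1 - s"] s01 by simp
    then have "cmod (of_real (r * (1 - s)) + of_real s * loop (?\<theta> (j + 1))) \<ge> 1 / 4"
      using s01 by (intro norm_loop_combination_ge[of _ _ 1]) auto
    then have "1 / 4 * (1 / 4) * cmod c \<le> cmod main"
      unfolding main_def norm_mult by (intro mult_mono loop_ge mult_nonneg_nonneg) auto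
    then have main: "cmod c / 16 \<le> cmod main" by simp
    have "cmod err1 \<le> C ^ (j + 2) * 2 / freq j"
      unfolding err1_def using ds by (intro norm_P) simp
    then have "cmod (of_real r * err1) \<le> r * (C ^ (j + 2) * 2 / freq j)"
      unfolding norm_mult norm_of_real using r1 by (intro mult_mono) auto
    \<comment> \<open>The amplitude ratio magnifies the error of layer \<open>i\<close>. Its growth
      is geometric, like that of the cutoff derivatives, so \<open>freq j\<close> absorbs both
      provided 4 C <= B.\<close>
    also have "\<dots> \<le> 4 ^ (j + 1) * (C ^ (j + 2) * 2 / freq j)"
    proof (rule mult_right_mono)
      have "r \<le> 2 ^ (2 * (j + 1))" unfolding r_def ji by (rule power_increasing) auto
      then show "r \<le> 4 ^ (j + 1)" by (simp only: power_mult) simp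
      show "0 \<le> C ^ (j + 2) * 2 / freq j" using C(1) freq_pos[of j] by simp
    qed
    also have "\<dots> = 2 * C * (4 * C / B) ^ Suc j"
      by (simp add: freq_def power_divide power_mult_distrib)
    also have "\<dots> \<le> 2 * C * (4 * C / B)"
      using CB C(1) power_decreasing[of 1 "Suc j" "4 * C / B"] by (intro mult_left_mono) auto
    also have "\<dots> = 8 * (C\<^sup>2 / B)" by (simp add: power2_eq_square)
    finally have e1: "cmod (of_real r * err1) \<le> 8 / 1000" using CB(2) by linarith
    have "cmod (loop_deriv (?\<theta> j) * (of_real (freq j) * c) * of_real s + loop (?\<theta> j) * ds) \<le>
        5 * (freq j * cmod c) * 1 + 2 * C ^ (j + 2)"
    proof (rule norm_triangle_le[OF add_mono])
      show "cmod (loop_deriv (?\<theta> j) * (of_real (freq j) * c) * of_real s) \<le> 5 * (freq j * cmod c) * 1"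
        unfolding norm_mult using norm_loop_deriv_le[of "?\<theta> j"] s01 freq_pos[of j]
        by (intro mult_mono) auto
      show "cmod (loop (?\<theta> j) * ds) \<le> 2 * C ^ (j + 2)"
        unfolding norm_mult using norm_loop_le[of "?\<theta> j"] ds by (intro mult_mono) auto
    qed
    then have "cmod err2 \<le> (5 * (freq j * cmod c) * 1 + 2 * C ^ (j + 2)) * 2 / freq (j + 1)"
      unfolding err2_def by (rule norm_P)
    also have "\<dots> = 10 * cmod c * (1 / B) + 4 * (C / B) ^ (j + 2)"
      using Bpos by (simp add: freq_def field_simps power_divide)
    also have "\<dots> \<le> 10 * cmod c * (1 / 1000) + 4 * (1 / 1000)"
    proof (intro add_mono mult_left_mono CB)
      have "(C / B) ^ (j + 2) \<le> (C / B) ^ 1" using CB(1,5) by (intro power_decreasing; linarith)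
      then show "(C / B) ^ (j + 2) \<le> 1 / 1000" using CB(1) unfolding power_one_right by (rule order_trans)
    qed auto
    finally have e2: "cmod err2 \<le> 10 * cmod c * (1 / 1000) + 4 * (1 / 1000)" .
    \<comment> \<open>The errors total at most 12/1000 + |c|/100, which is below |c|/16 because |c|
      >= 1/2.\<close>
    have "cmod (of_real r * err1 + err2) < cmod main"
      using norm_triangle_ineq[of "of_real r * err1" err2] e1 e2 main c by linarith
    then have "main + (of_real r * err1 + err2) \<noteq> 0"
      by (metis add_eq_0_iff norm_minus_cancel order_less_irrefl)
    then show ?thesis unfolding tot by simp
  qed
qed

end

lemma ex_smooth_with_cr_zero_set:
  assumes "closed K" "K \<subseteq> S3" "(0, 1) \<in> K"
  obtains q :: "complex \<times> complex \<Rightarrow> complex" where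
    "\<And>m. moderate_upto annulus m (\<lambda>_. q)" "\<And>x. q (sgn x) = q x"
    "\<And>p. p \<in> S3 \<Longrightarrow> cr q p = 0 \<longleftrightarrow> p \<in> K"
    "\<And>p vs. p \<in> K \<Longrightarrow> iter_deriv vs q p = 0"
proof -
  obtain \<rho> where \<rho>: "\<And>m. moderate_upto annulus m (\<lambda>_ x. \<rho> (x /\<^sub>R norm x))"
    "\<And>y. y \<in> S3 \<Longrightarrow> 0 \<le> \<rho> y" "\<And>y. y \<in> S3 \<Longrightarrow> \<rho> y \<le> 1"
    "\<And>y. y \<in> S3 \<Longrightarrow> 4 * \<rho> y \<le> pole_dist2 y"
    "\<And>y. y \<in> S3 \<Longrightarrow> \<rho> y = 0 \<longleftrightarrow> y \<in> K"
    by (rule ex_weight[OF assms], rule that; blast)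
  have corr: "corrugation \<rho> B" if "B \<ge> 1" for B
    by unfold_locales (use \<rho> that in \<open>auto simp: sgn_div_norm\<close>)
  \<comment> \<open>This copy serves only to obtain \<open>C\<close>; its cutoffs are those of the
    copy with large frequency base below.\<close>
  interpret C1: corrugation \<rho> 1 by (rule corr) simp
  obtain C where C: "C \<ge> 1" "\<And>k p. p \<in> S3 \<Longrightarrow> cmod (C1.d_cutoff k p) \<le> C ^ Suc k"
    by (rule C1.norm_d_cutoff_bound, rule that; blast)
  have "1 \<le> C\<^sup>2" using C(1) by (simp add: one_le_power)
  then interpret corrugation \<rho> "1000 * C\<^sup>2" by (intro corr) simp
  show ?thesis
  proof (rule that)
    show "moderate_upto annulus m (\<lambda>_. corrugated)" for m by (rule moderate_corrugated)
    show "corrugated (sgn x) = corrugated x" for x by (rule corrugated_sgn)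
    show "cr corrugated p = 0 \<longleftrightarrow> p \<in> K" if p: "p \<in> S3" for p
    proof (cases "\<rho> p = 0")
      case True
      then show ?thesis using cr_corrugated_zero[OF p] \<rho>(5)[OF p] by simp
    next
      case False
      then have "\<rho> p > 0" using \<rho>(2)[OF p] by simp
      from cr_corrugated_nonzero[OF C order_refl p this] show ?thesis using False \<rho>(5)[OF p] by simp
    qed
    show "iter_deriv vs corrugated p = 0" if "p \<in> K" for p vs
      using corrugated_flat[of p vs] \<rho>(5)[of p] assms(2) that by auto
  qed
qed

section \<open>Complex tangents of graphs\<close>

lemma Ck_on_1_curve:
  fixes \<gamma> :: "real \<Rightarrow> 'b::real_normed_vector"
  assumes "\<And>t. t \<in> U \<Longrightarrow> (\<gamma> has_vector_derivative \<gamma>' t) (at t)" "continuous_on U \<gamma>'"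
  shows "Ck_on 1 U \<gamma>"
proof -
  have fd: "frechet_derivative \<gamma> (at t) w = w *\<^sub>R \<gamma>' t" if "t \<in> U" for t w
    using assms(1)[OF that] fun_cong[OF frechet_derivative_at[of \<gamma> "\<lambda>w. w *\<^sub>R \<gamma>' t" t], of w]
    by (simp add: has_vector_derivative_def)
  have dif: "\<gamma> differentiable (at t)" if "t \<in> U" for t
    using assms(1)[OF that] by (auto simp: has_vector_derivative_def differentiable_def)
  have cont: "continuous_on U \<gamma>"
    using dif by (intro continuous_at_imp_continuous_on ballI differentiable_imp_continuous_within)
  show ?thesis
    unfolding Ck_on_def
  proof (intro conjI allI impI)
    fix vs :: "real list" assume "enat (length vs) < 1"
    then have "vs = []" by (simp add: one_enat_def)
    then show "\<forall>x\<in>U. iter_deriv vs \<gamma> differentiable at x" using dif by simp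
  next
    fix vs :: "real list" assume "enat (length vs) \<le> 1"
    then consider "vs = []" | w where "vs = [w]"
      by (cases vs) (auto simp: one_enat_def)
    then show "continuous_on U (iter_deriv vs \<gamma>)"
    proof cases
      case 1
      then show ?thesis using cont by simp
    next
      case 2
      have "continuous_on U (\<lambda>t. w *\<^sub>R \<gamma>' t)" by (intro continuous_intros assms(2))
      then show ?thesis using fd 2 by (simp cong: continuous_on_cong)
    qed
  qed
qed

lemma velocity_orthogonal_S3:
  assumes "\<epsilon> > 0" "\<gamma> ` {-\<epsilon><..<\<epsilon>} \<subseteq> S3" "(\<gamma> has_vector_derivative v) (at 0)"
  shows "v \<bullet> \<gamma> 0 = 0"
proof -
  have "((\<lambda>t. \<gamma> t \<bullet> \<gamma> t) has_vector_derivative \<gamma> 0 \<bullet> v + v \<bullet> \<gamma> 0) (at 0)"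
    using has_derivative_inner[of \<gamma> _ 0 UNIV \<gamma>] assms(3)
    by (fastforce simp: has_vector_derivative_def algebra_simps)
  then have "((\<lambda>t. 1) has_vector_derivative \<gamma> 0 \<bullet> v + v \<bullet> \<gamma> 0) (at (0::real))"
  proof (rule has_vector_derivative_transform_within_open[of _ _ _ "{-\<epsilon><..<\<epsilon>}"])
    fix t assume "t \<in> {-\<epsilon><..<\<epsilon>}"
    then have "\<gamma> t \<in> S3" using assms(2) by blast
    then have "norm (\<gamma> t) = 1" by (simp add: S3_eq_sphere)
    then show "\<gamma> t \<bullet> \<gamma> t = 1" by (simp add: norm_eq_1)
  qed (use assms(1) in auto)
  then have "\<gamma> 0 \<bullet> v + v \<bullet> \<gamma> 0 = 0"
    using vector_derivative_unique_at[OF _ has_vector_derivative_const] by blast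
  then show ?thesis by (simp add: inner_commute)
qed

lemma great_circle:
  assumes "x \<in> S3" "v \<bullet> x = 0"
  obtains \<delta> \<delta>' where "\<And>t. (\<delta> has_vector_derivative \<delta>' t) (at t)" "continuous_on UNIV \<delta>'"
    "\<And>t. \<delta> t \<in> S3" "\<delta> 0 = x" "\<delta>' 0 = v"
proof -
  \<comment> \<open>For v = 0 this gives e = 0 and the curve is constant, as it should be.\<close>
  define e where "e = v /\<^sub>R norm v"
  define \<delta> where "\<delta> t = cos (norm v * t) *\<^sub>R x + sin (norm v * t) *\<^sub>R e" for t
  define \<delta>' where "\<delta>' t = (- norm v * sin (norm v * t)) *\<^sub>R x + (norm v * cos (norm v * t)) *\<^sub>R e" for t
  have e: "norm v *\<^sub>R e = v" "x \<bullet> e = 0" "e \<bullet> x = 0"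
    using assms(2) by (cases "v = 0"; simp add: e_def inner_commute)+
  show ?thesis
  proof (rule that)
    fix t
    have "((\<lambda>t. cos (norm v * t)) has_real_derivative - norm v * sin (norm v * t)) (at t)"
      "((\<lambda>t. sin (norm v * t)) has_real_derivative norm v * cos (norm v * t)) (at t)"
      by (auto intro!: derivative_eq_intros)
    then have "(\<delta> has_vector_derivative
        (cos (norm v * t) *\<^sub>R 0 + (- norm v * sin (norm v * t)) *\<^sub>R x) +
        (sin (norm v * t) *\<^sub>R 0 + (norm v * cos (norm v * t)) *\<^sub>R e)) (at t)"
      unfolding \<delta>_def
      by (intro has_vector_derivative_add has_vector_derivative_scaleR has_vector_derivative_const)
    then show "(\<delta> has_vector_derivative \<delta>' t) (at t)" by (simp add: \<delta>'_def)
    have "x \<bullet> x = 1" using assms(1) by (simp add: S3_eq_sphere norm_eq_1)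
    moreover have "sin (norm v * t) * sin (norm v * t) * (e \<bullet> e) = sin (norm v * t) * sin (norm v * t)"
    proof (cases "v = 0")
      case False
      then have "e \<bullet> e = 1" by (simp add: e_def dot_square_norm power2_eq_square)
      then show ?thesis by simp
    qed simp
    moreover have "\<delta> t \<bullet> \<delta> t = cos (norm v * t) * cos (norm v * t) * (x \<bullet> x) +
        sin (norm v * t) * sin (norm v * t) * (e \<bullet> e)"
      using e by (simp add: \<delta>_def inner_add)
    ultimately have "\<delta> t \<bullet> \<delta> t = (cos (norm v * t))\<^sup>2 + (sin (norm v * t))\<^sup>2"
      by (simp only: power2_eq_square mult_1_right)
    then show "\<delta> t \<in> S3" by (simp add: S3_eq_sphere norm_eq_1)
  next
    show "continuous_on UNIV \<delta>'" unfolding \<delta>'_def by (intro continuous_intros)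
    show "\<delta> 0 = x" by (simp add: \<delta>_def)
    show "\<delta>' 0 = v" by (simp add: \<delta>'_def e)
  qed
qed

text \<open>The two real conditions together say that the Hermitian product of \<open>u\<close> with
  \<open>x\<close> is 0, so \<open>u\<close> is a complex multiple of \<open>tau x\<close>. The
  multiplier is the determinant of \<open>x\<close> and \<open>u\<close>, and \<open>a\<close>,
  \<open>b\<close> are its real and imaginary parts.\<close>

lemma complex_tangent_multiple_tau:
  assumes "x \<in> S3" "u \<bullet> x = 0" "(\<i> * fst u, \<i> * snd u) \<bullet> x = 0"
  obtains a b where "u = a *\<^sub>R tau x + b *\<^sub>R i_tau x"
    "(\<i> * fst u, \<i> * snd u) = a *\<^sub>R i_tau x - b *\<^sub>R tau x"
proof -
  obtain z w where x: "x = (z, w)" by (cases x)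
  obtain u1 u2 where u: "u = (u1, u2)" by (cases u)
  have "complex_of_real ((cmod z)\<^sup>2 + (cmod w)\<^sup>2) = 1"
    using assms(1) x by (simp add: S3_def del: of_real_add)
  then have zz: "z * cnj z + w * cnj w = 1" by (simp only: of_real_add complex_norm_square)
  have orth: "u1 * cnj z + u2 * cnj w = 0"
    using assms(2,3) by (simp add: x u inner_prod_def inner_complex_def complex_eq_iff algebra_simps)
  define l where "l = u2 * z - u1 * w"
  have "l * (- cnj w) = u1 * (z * cnj z + w * cnj w) - z * (u1 * cnj z + u2 * cnj w)"
    by (simp add: l_def algebra_simps)
  then have 1: "u1 = l * (- cnj w)" by (simp add: zz orth)
  have "l * cnj z = u2 * (z * cnj z + w * cnj w) - w * (u1 * cnj z + u2 * cnj w)"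
    by (simp add: l_def algebra_simps)
  then have 2: "u2 = l * cnj z" by (simp add: zz orth)
  have l: "l = complex_of_real (Re l) + \<i> * complex_of_real (Im l)" by (rule complex_eq)
  show ?thesis
  proof (rule that[of "Re l" "Im l"])
    show "u = Re l *\<^sub>R tau x + Im l *\<^sub>R i_tau x"
      unfolding u 1 2 by (subst (1 2) l) (simp add: x tau_def i_tau_def scaleR_conv_of_real algebra_simps)
    show "(\<i> * fst u, \<i> * snd u) = Re l *\<^sub>R i_tau x - Im l *\<^sub>R tau x"
      unfolding u fst_conv snd_conv 1 2
      by (subst (1 2) l) (simp add: x tau_def i_tau_def scaleR_conv_of_real algebra_simps)
  qed
qed

lemma tau_orthogonal: "tau x \<bullet> x = 0" "i_tau x \<bullet> x = 0"
  by (cases x; simp add: tau_def i_tau_def inner_prod_def inner_complex_def algebra_simps)+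

section \<open>Graphs over the sphere: embedding property and tangent spaces\<close>

lemma moderate_upto_id: "moderate_upto annulus m (\<lambda>_ x::'a::euclidean_space. x)"
proof -
  have 0: "moderate_upto annulus 0 (\<lambda>_ x::'a. x)"
    by (rule moderate_upto_const_bound[of _ _ 2]) (auto simp: annulus_def)
  show ?thesis
  proof (cases m)
    case (Suc n)
    show ?thesis
      unfolding Suc
      by (rule moderate_upto_SucI[OF open_annulus 0 _ moderate_upto_constant[OF open_annulus]])
        (rule has_derivative_ident)
  qed (use 0 in simp)
qed

definition graph_map :: "(complex \<times> complex \<Rightarrow> complex) \<Rightarrow> complex \<times> complex \<Rightarrow> complex \<times> complex \<times> complex" where
  "graph_map q x = (fst x, snd x, q x)"

lemma graph_map_has_derivative:
  assumes "q differentiable (at x)"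
  shows "(graph_map q has_derivative (\<lambda>v. (fst v, snd v, frechet_derivative q (at x) v))) (at x)"
  unfolding graph_map_def[abs_def] using assms unfolding frechet_derivative_works
  by (intro has_derivative_Pair has_derivative_fst has_derivative_snd has_derivative_ident)

lemma frechet_derivative_graph_map:
  "q differentiable (at x) \<Longrightarrow>
    frechet_derivative (graph_map q) (at x) = (\<lambda>v. (fst v, snd v, frechet_derivative q (at x) v))"
  by (rule frechet_derivative_at[OF graph_map_has_derivative, symmetric])

lemma moderate_upto_graph_map:
  assumes "moderate_upto annulus m (\<lambda>_. q)"
  shows "moderate_upto annulus m (\<lambda>_. graph_map q)"
proof -
  have 1: "bounded_linear (\<lambda>x::complex \<times> complex. (fst x, snd x, 0::complex))"
    by (intro bounded_linear_Pair bounded_linear_fst bounded_linear_snd bounded_linear_zero)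
  have 2: "bounded_linear (\<lambda>c::complex. (0::complex, 0::complex, c))"
    by (intro bounded_linear_Pair bounded_linear_ident bounded_linear_zero)
  have "moderate_upto annulus m (\<lambda>_ x. (fst x, snd x, 0) + (0, 0, q x))"
    by (intro moderate_upto_add open_annulus moderate_upto_bounded_linear[OF open_annulus 1 moderate_upto_id]
        moderate_upto_bounded_linear[OF open_annulus 2 assms])
  then show ?thesis by (simp add: graph_map_def[abs_def])
qed

text \<open>Projection to the first two coordinates inverts the graph map, and the corresponding
  components of its derivative give injectivity. \<open>k\<close> and \<open>M\<close> are general
  so as to cover finite order on the sphere and infinite order on the punctured sphere.\<close>

lemma Ck_embedding_graph_map:
  assumes q: "\<And>m. moderate_upto annulus m (\<lambda>_. q)" and M: "M \<subseteq> annulus"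
  shows "Ck_embedding k M (graph_map q)"
proof -
  have ck: "Ck_on k annulus (graph_map q)"
    by (rule Ck_on_moderate[OF moderate_upto_graph_map[OF q]])
  then have ext: "Ck_extension k M (graph_map q) x (graph_map q)" if "x \<in> M" for x
    unfolding Ck_extension_def using open_annulus M that by blast
  have d: "q differentiable (at x)" if "x \<in> M" for x
    using moderate_upto_differentiable[OF q[of "Suc 0"]] M that by blast
  have "continuous_on M (graph_map q)"
    using graph_map_has_derivative[OF d] has_derivative_continuous
    by (intro continuous_at_imp_continuous_on ballI) blast
  then have "homeomorphism M (graph_map q ` M) (graph_map q) (\<lambda>y. (fst y, fst (snd y)))"
    by (intro homeomorphismI continuous_intros) (auto simp: graph_map_def)
  moreover have "inj_on (frechet_derivative (graph_map q) (at x)) T" if "x \<in> M" for x T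
    unfolding frechet_derivative_graph_map[OF d[OF that]] by (auto simp: inj_on_def prod_eq_iff)
  ultimately show ?thesis
    unfolding Ck_embedding_def Ck_map_def using ext by blast
qed

text \<open>A curve in the graph projects to a curve in the sphere, whose velocity is orthogonal to
  \<open>x\<close>, and is recovered by composing with the graph map. Conversely each orthogonal
  vector is the velocity of a great circle, which is lifted to the graph.\<close>

lemma tangent_space_graph:
  assumes q: "\<And>m. moderate_upto annulus m (\<lambda>_. q)" and x: "x \<in> S3"
  shows "tangent_space (graph_map q ` S3) (graph_map q x) =
    (\<lambda>v. (fst v, snd v, frechet_derivative q (at x) v)) ` {v. v \<bullet> x = 0}"
proof (intro set_eqI iffI)
  have d: "q differentiable (at y)" if "y \<in> S3" for y
    using moderate_upto_differentiable[OF q[of "Suc 0"]] S3_subset_annulus that by blast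
  let ?pr = "\<lambda>y::complex \<times> complex \<times> complex. (fst y, fst (snd y))"
  have pr: "bounded_linear ?pr"
    by (intro bounded_linear_Pair bounded_linear_fst
        bounded_linear_compose[OF bounded_linear_fst bounded_linear_snd])
  {
    fix V assume "V \<in> tangent_space (graph_map q ` S3) (graph_map q x)"
    then obtain \<gamma> and \<epsilon> :: real where \<gamma>: "\<epsilon> > 0" "\<gamma> ` {-\<epsilon><..<\<epsilon>} \<subseteq> graph_map q ` S3"
      "\<gamma> 0 = graph_map q x" "(\<gamma> has_vector_derivative V) (at 0)"
      by (auto simp: tangent_space_def)
    define \<delta> where "\<delta> t = ?pr (\<gamma> t)" for t
    have \<delta>0: "\<delta> 0 = x" by (simp add: \<delta>_def \<gamma>(3) graph_map_def)
    have \<delta>': "(\<delta> has_vector_derivative ?pr V) (at 0)"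
      unfolding \<delta>_def by (rule bounded_linear.has_vector_derivative[OF pr \<gamma>(4)])
    have \<gamma>\<delta>: "\<gamma> t = graph_map q (\<delta> t)" "\<delta> t \<in> S3" if "t \<in> {-\<epsilon><..<\<epsilon>}" for t
    proof -
      have "\<gamma> t \<in> graph_map q ` S3" using \<gamma>(2) that by blast
      then show "\<gamma> t = graph_map q (\<delta> t)" "\<delta> t \<in> S3" by (auto simp: \<delta>_def graph_map_def)
    qed
    have "?pr V \<bullet> \<delta> 0 = 0"
      by (rule velocity_orthogonal_S3[OF \<gamma>(1) _ \<delta>']) (use \<gamma>\<delta>(2) in auto)
    then have orth: "?pr V \<bullet> x = 0" by (simp only: \<delta>0)
    have "((\<lambda>t. graph_map q (\<delta> t)) has_derivative
        (\<lambda>h. (fst (h *\<^sub>R ?pr V), snd (h *\<^sub>R ?pr V), frechet_derivative q (at x) (h *\<^sub>R ?pr V)))) (at 0)"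
      using has_derivative_compose[OF \<delta>'[unfolded has_vector_derivative_def]]
        graph_map_has_derivative[OF d[OF x]] unfolding \<delta>0 by blast
    moreover have "frechet_derivative q (at x) (h *\<^sub>R fst V, h *\<^sub>R fst (snd V)) =
        h *\<^sub>R frechet_derivative q (at x) (fst V, fst (snd V))" for h
      using linear_scale[OF linear_frechet_derivative[OF d[OF x]], of h "(fst V, fst (snd V))"] by simp
    ultimately have "((\<lambda>t. graph_map q (\<delta> t)) has_vector_derivative
        (fst (?pr V), snd (?pr V), frechet_derivative q (at x) (?pr V))) (at 0)"
      by (simp add: has_vector_derivative_def)
    then have "(\<gamma> has_vector_derivative
        (fst (?pr V), snd (?pr V), frechet_derivative q (at x) (?pr V))) (at 0)"
      by (rule has_vector_derivative_transform_within_open[of _ _ _ "{-\<epsilon><..<\<epsilon>}"])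
        (use \<gamma>\<delta>(1) \<gamma>(1) in auto)
    then have "V = (fst (?pr V), snd (?pr V), frechet_derivative q (at x) (?pr V))"
      by (rule vector_derivative_unique_at[OF \<gamma>(4)])
    then show "V \<in> (\<lambda>v. (fst v, snd v, frechet_derivative q (at x) v)) ` {v. v \<bullet> x = 0}"
      using orth by blast
  next
    fix V assume "V \<in> (\<lambda>v. (fst v, snd v, frechet_derivative q (at x) v)) ` {v. v \<bullet> x = 0}"
    then obtain v where v: "v \<bullet> x = 0" and V: "V = (fst v, snd v, frechet_derivative q (at x) v)"
      by blast
    obtain \<delta> \<delta>' where \<delta>: "\<And>t. (\<delta> has_vector_derivative \<delta>' t) (at t)" "continuous_on UNIV \<delta>'"
      "\<And>t. \<delta> t \<in> S3" "\<delta> 0 = x" "\<delta>' 0 = v"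
      using great_circle[OF x v] by metis
    define \<gamma> where "\<gamma> t = graph_map q (\<delta> t)" for t
    define \<gamma>' where "\<gamma>' t = (fst (\<delta>' t), snd (\<delta>' t), frechet_derivative q (at (\<delta> t)) (\<delta>' t))" for t
    have lin: "linear (frechet_derivative q (at (\<delta> t)))" for t
      using d[OF \<delta>(3)] by (rule linear_frechet_derivative)
    have \<gamma>': "(\<gamma> has_vector_derivative \<gamma>' t) (at t)" for t
      using has_derivative_compose[OF \<delta>(1)[unfolded has_vector_derivative_def, of t]
          graph_map_has_derivative[OF d[OF \<delta>(3)]]]
      by (simp add: has_vector_derivative_def \<gamma>_def[abs_def] \<gamma>'_def linear_scale[OF lin])
    have c\<delta>: "continuous_on UNIV \<delta>"
      using \<delta>(1) has_vector_derivative_continuous by (intro continuous_at_imp_continuous_on) blast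
    have cq: "continuous_on UNIV (\<lambda>t. frechet_derivative q (at (\<delta> t)) b)" for b
    proof -
      have "moderate_upto annulus (Suc 0) (\<lambda>_ x. frechet_derivative q (at x) b)"
        using q[of "Suc (Suc 0)"] unfolding moderate_upto.simps(2)[of _ "Suc 0"] by blast
      then have "(\<lambda>y. frechet_derivative q (at y) b) differentiable (at y)" if "y \<in> annulus" for y
        using that by simp
      then have "continuous_on annulus (\<lambda>y. frechet_derivative q (at y) b)"
        by (intro continuous_at_imp_continuous_on ballI differentiable_imp_continuous_within)
      then show ?thesis
        by (rule continuous_on_compose2[OF _ c\<delta>]) (use \<delta>(3) S3_subset_annulus in blast)
    qed
    \<comment> \<open>Base point and direction both move with \<open>t\<close>. Expanding the
      direction in the basis reduces continuity to that of finitely many directional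
      derivatives.\<close>
    have "frechet_derivative q (at (\<delta> t)) (\<delta>' t) =
        (\<Sum>b\<in>Basis. (\<delta>' t \<bullet> b) *\<^sub>R frechet_derivative q (at (\<delta> t)) b)" for t
      by (subst (1) euclidean_representation[of "\<delta>' t", symmetric])
        (simp only: linear_sum[OF lin] linear_scale[OF lin])
    moreover have "continuous_on UNIV (\<lambda>t. \<Sum>b\<in>Basis. (\<delta>' t \<bullet> b) *\<^sub>R frechet_derivative q (at (\<delta> t)) b)"
      by (intro continuous_intros cq \<delta>(2))
    ultimately have "continuous_on UNIV \<gamma>'"
      unfolding \<gamma>'_def by (intro continuous_intros \<delta>(2)) simp
    then have "continuous_on {-1<..<1} \<gamma>'" by (rule continuous_on_subset) simp
    then have "Ck_on 1 {-1<..<1} \<gamma>" using \<gamma>' by (intro Ck_on_1_curve)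
    moreover have "\<gamma> ` {-1<..<1} \<subseteq> graph_map q ` S3" using \<delta>(3) by (auto simp: \<gamma>_def)
    moreover have "\<gamma> 0 = graph_map q x" by (simp add: \<gamma>_def \<delta>(4))
    moreover have "(\<gamma> has_vector_derivative V) (at 0)"
      using \<gamma>'[of 0] by (simp add: \<gamma>'_def V \<delta>(4,5))
    ultimately show "V \<in> tangent_space (graph_map q ` S3) (graph_map q x)"
      unfolding tangent_space_def by (intro CollectI exI[of _ \<gamma>] exI[of _ 1]) simp
  }
qed

lemma complex_tangents_graph:
  assumes q: "\<And>m. moderate_upto annulus m (\<lambda>_. q)"
  shows "complex_tangents_in_S3 (graph_map q) = {x \<in> S3. cr q x = 0}"
proof -
  have "graph_map q x \<in> complex_tangents (graph_map q ` S3) \<longleftrightarrow> cr q x = 0" if x: "x \<in> S3" for x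
  proof -
    let ?D = "frechet_derivative q (at x)"
    let ?G = "\<lambda>v. (fst v, snd v, ?D v)"
    let ?T = "?G ` {v. v \<bullet> x = 0}"
    have lin: "linear ?D"
      by (rule linear_frechet_derivative[OF moderate_upto_differentiable[OF q[of "Suc 0"]
            subsetD[OF S3_subset_annulus x]]])
    have "?T \<inter> J ` ?T \<noteq> {0} \<longleftrightarrow> cr q x = 0"
    proof
      assume cr0: "cr q x = 0"
      have "?D (i_tau x) = \<i> * ?D (tau x)" using cr0 by (simp only: cr_def right_minus_eq)
      then have g1: "?G (i_tau x) = J (?G (tau x))" by (simp add: J_def tau_def i_tau_def)
      have g2: "?G (i_tau x) \<in> ?T" "?G (tau x) \<in> ?T"
        by (rule imageI, simp only: mem_Collect_eq tau_orthogonal)+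
      have "?G (i_tau x) \<in> ?T \<inter> J ` ?T" by (rule IntI[OF g2(1) image_eqI[of _ J, OF g1 g2(2)]])
      moreover have "?G (i_tau x) \<noteq> 0"
      proof
        assume "?G (i_tau x) = 0"
        then have "i_tau x = 0" by (simp add: zero_prod_def prod_eq_iff)
        then show False using norm_i_tau[OF x] by simp
      qed
      ultimately show "?T \<inter> J ` ?T \<noteq> {0}" by blast
    next
      assume ne: "?T \<inter> J ` ?T \<noteq> {0}"
      \<comment> \<open>The inequality with \<open>{0}\<close> would also hold for an empty
        intersection, so 0 is shown to belong to it before a nonzero element is chosen.\<close>
      have "?G 0 = 0" using linear_0[OF lin] by (simp add: zero_prod_def)
      then have 0: "0 \<in> ?T" by (intro image_eqI[of _ _ 0]) simp_all
      have "0 = J 0" by (simp add: J_def zero_prod_def)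
      from image_eqI[of 0 J, OF this 0] 0 have "0 \<in> ?T \<inter> J ` ?T" by (rule IntI[rotated])
      with ne obtain y where y: "y \<in> ?T" "y \<in> J ` ?T" "y \<noteq> 0" by blast
      from y(1) obtain v where v: "v \<bullet> x = 0" "y = ?G v" by (elim imageE CollectE) simp
      from y(2) obtain u where u: "u \<bullet> x = 0" "y = J (?G u)" by (elim imageE CollectE) simp
      have vu: "v = (\<i> * fst u, \<i> * snd u)" "?D v = \<i> * ?D u"
        using v(2) u(2) by (simp_all add: J_def prod_eq_iff)
      have orth: "(\<i> * fst u, \<i> * snd u) \<bullet> x = 0" using v(1) vu(1) by simp
      obtain a b where ab: "u = a *\<^sub>R tau x + b *\<^sub>R i_tau x" "v = a *\<^sub>R i_tau x - b *\<^sub>R tau x"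
        unfolding vu(1) by (rule complex_tangent_multiple_tau[OF x u(1) orth])
      \<comment> \<open>With u = (a + i b) \<open>tau x\<close>, linearity of the derivative turns D
        v - i D u into this conjugate multiplier times \<open>cr q x\<close>.\<close>
      let ?l = "complex_of_real a - \<i> * complex_of_real b"
      have Dv: "?D v = a *\<^sub>R ?D (i_tau x) - b *\<^sub>R ?D (tau x)"
        unfolding ab(2) by (simp only: linear_diff[OF lin] linear_scale[OF lin])
      have Du: "?D u = a *\<^sub>R ?D (tau x) + b *\<^sub>R ?D (i_tau x)"
        unfolding ab(1) by (simp only: linear_add[OF lin] linear_scale[OF lin])
      have "a *\<^sub>R ?D (i_tau x) - b *\<^sub>R ?D (tau x) =
          \<i> * (a *\<^sub>R ?D (tau x) + b *\<^sub>R ?D (i_tau x))"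
        using vu(2) unfolding Dv Du .
      then have "?l * cr q x = 0"
        by (simp add: cr_def scaleR_conv_of_real algebra_simps)
      moreover have "?l \<noteq> 0"
      proof
        assume "?l = 0"
        then have "a = 0" "b = 0" by (simp_all add: complex_eq_iff)
        then have "v = 0" using ab(2) by simp
        with v(2) have "y = ?G 0" by (simp only:)
        with y(3) \<open>?G 0 = 0\<close> show False by (simp only:)
      qed
      ultimately show "cr q x = 0" by (metis mult_eq_0_iff)
    qed
    then show ?thesis
      using x by (simp add: complex_tangents_def tangent_space_graph[OF q x])
  qed
  then show ?thesis by (auto simp: complex_tangents_in_S3_def)
qed

section \<open>Rotating the knot to the pole and the conclusion\<close>

lemma is_knot_compact: "is_knot K \<Longrightarrow> compact K"
  unfolding is_knot_def using compact_continuous_image by (metis compact_sphere)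

lemma is_knot_homeomorphism:
  assumes "is_knot K" "homeomorphism S3 S3 h h'"
  shows "is_knot (h ` K)"
proof -
  obtain \<gamma> where \<gamma>: "K \<subseteq> S3" "continuous_on (sphere (0::complex) 1) \<gamma>" "inj_on \<gamma> (sphere 0 1)"
    "\<gamma> ` sphere 0 1 = K"
    using assms(1) by (auto simp: is_knot_def)
  have inj: "inj_on h S3"
    using homeomorphism_apply1[OF assms(2)] by (rule inj_on_inverseI)
  have h: "continuous_on S3 h" "h ` S3 = S3" using assms(2) by (auto simp: homeomorphism_def)
  have "continuous_on (sphere 0 1) (h \<circ> \<gamma>)"
    using \<gamma> h continuous_on_subset by (intro continuous_on_compose) auto
  moreover have "inj_on (h \<circ> \<gamma>) (sphere 0 1)"
    using \<gamma> inj inj_on_subset by (intro comp_inj_on) auto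
  moreover have "h ` K \<subseteq> S3" using h \<gamma> by blast
  ultimately show ?thesis
    unfolding is_knot_def using \<gamma>(4) by (metis image_comp)
qed

text \<open>\<open>h\<close> is the element of SU(2) whose second row is the conjugate of
  \<open>p\<close>, and \<open>h'\<close> is its conjugate transpose. Invertibility and invariance
  of the sphere both reduce to \<open>ab\<close>.\<close>

lemma rotate_to_pole:
  assumes "p \<in> S3"
  obtains h h' where "homeomorphism S3 S3 h h'" "h p = (0, 1)"
proof -
  obtain a b where p: "p = (a, b)" by (cases p)
  have "complex_of_real ((cmod a)\<^sup>2 + (cmod b)\<^sup>2) = 1"
    using assms p by (simp add: S3_def del: of_real_add)
  then have ab: "a * cnj a + b * cnj b = 1" by (simp only: of_real_add complex_norm_square)
  have S3_iff: "(z, w) \<in> S3 \<longleftrightarrow> z * cnj z + w * cnj w = 1" for z w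
  proof -
    have "(z, w) \<in> S3 \<longleftrightarrow> complex_of_real ((cmod z)\<^sup>2 + (cmod w)\<^sup>2) = complex_of_real 1"
      by (simp only: S3_def of_real_eq_iff) simp
    then show ?thesis by (simp only: of_real_add complex_norm_square of_real_1)
  qed
  define h where "h x = (b * fst x - a * snd x, cnj a * fst x + cnj b * snd x)" for x
  define h' where "h' x = (cnj b * fst x + a * snd x, - cnj a * fst x + b * snd x)" for x
  have hh': "h' (h x) = x" for x
  proof -
    have "fst (h' (h x)) = (a * cnj a + b * cnj b) * fst x"
      "snd (h' (h x)) = (a * cnj a + b * cnj b) * snd x"
      by (simp_all add: h_def h'_def algebra_simps)
    then show ?thesis by (simp add: ab prod_eq_iff)
  qed
  have h'h: "h (h' x) = x" for x
  proof -
    have "fst (h (h' x)) = (a * cnj a + b * cnj b) * fst x"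
      "snd (h (h' x)) = (a * cnj a + b * cnj b) * snd x"
      by (simp_all add: h_def h'_def algebra_simps)
    then show ?thesis by (simp add: ab prod_eq_iff)
  qed
  have hS: "h x \<in> S3" if "x \<in> S3" for x
  proof -
    have "(b * z - a * w) * cnj (b * z - a * w) + (cnj a * z + cnj b * w) * cnj (cnj a * z + cnj b * w) =
        (a * cnj a + b * cnj b) * (z * cnj z + w * cnj w)" for z w
      by (simp add: algebra_simps)
    then show ?thesis
      using that by (cases x) (simp only: h_def fst_conv snd_conv S3_iff ab mult_1)
  qed
  have h'S: "h' x \<in> S3" if "x \<in> S3" for x
  proof -
    have "(cnj b * z + a * w) * cnj (cnj b * z + a * w) + (- cnj a * z + b * w) * cnj (- cnj a * z + b * w) =
        (a * cnj a + b * cnj b) * (z * cnj z + w * cnj w)" for z w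
      by (simp add: algebra_simps)
    then show ?thesis
      using that by (cases x) (simp only: h'_def fst_conv snd_conv S3_iff ab mult_1)
  qed
  have "homeomorphism S3 S3 h h'"
  proof (rule homeomorphismI)
    show "continuous_on S3 h" unfolding h_def by (intro continuous_intros)
    show "continuous_on S3 h'" unfolding h'_def by (intro continuous_intros)
  qed (use hS h'S hh' h'h in auto)
  moreover have "h p = (0, 1)" using ab by (simp add: p h_def algebra_simps)
  ultimately show ?thesis by (rule that)
qed

theorem theorem13:
  fixes K :: "(complex \<times> complex) set" and n :: nat
  assumes "is_knot K" and "n \<ge> 1"
  shows "\<exists>Q :: complex \<times> complex \<Rightarrow> complex \<times> complex \<times> complex.
           Ck_embedding (enat n) S3 Q \<and>
           is_knot (complex_tangents_in_S3 Q) \<and>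
           knot_equivalent K (complex_tangents_in_S3 Q) \<and>
           (\<exists>q p. (\<forall>(z, w)\<in>S3. Q (z, w) = (z, w, q (z, w))) \<and>
              Ck_embedding \<infinity> (S3 - {p}) Q \<and>
              p \<in> complex_tangents_in_S3 Q \<and>
              degenerate_at q p)"
proof -
  obtain \<gamma> :: "complex \<Rightarrow> complex \<times> complex" where "K \<subseteq> S3" "\<gamma> ` sphere 0 1 = K"
    using assms(1) by (auto simp: is_knot_def)
  moreover have "(1::complex) \<in> sphere 0 1" by simp
  ultimately obtain p where p: "p \<in> K" "p \<in> S3" by blast
  obtain h h' where h: "homeomorphism S3 S3 h h'" "h p = (0, 1)"
    using rotate_to_pole[OF p(2)] by metis
  define K' where "K' = h ` K"
  have knot: "is_knot K'" unfolding K'_def by (rule is_knot_homeomorphism[OF assms(1) h(1)])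
  have K': "closed K'" "K' \<subseteq> S3" "(0, 1) \<in> K'"
    using is_knot_compact[OF knot] compact_imp_closed knot p(1) h(2)
    by (auto simp: is_knot_def K'_def intro: rev_image_eqI)
  obtain q where q: "\<And>m. moderate_upto annulus m (\<lambda>_. q)" "\<And>x. q (sgn x) = q x"
    "\<And>p. p \<in> S3 \<Longrightarrow> cr q p = 0 \<longleftrightarrow> p \<in> K'" "\<And>p vs. p \<in> K' \<Longrightarrow> iter_deriv vs q p = 0"
    using ex_smooth_with_cr_zero_set[OF K'] by metis
  have ct: "complex_tangents_in_S3 (graph_map q) = K'"
    unfolding complex_tangents_graph[OF q(1)] using q(3) K'(2) by auto
  \<comment> \<open>Being constant along rays, \<open>q\<close> is its own radial extension, so the
    ambient derivatives shown to vanish on \<open>K'\<close> are those in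
    \<open>degenerate_at\<close>.\<close>
  have "radial_extension q = q"
    using q(2) by (simp add: radial_extension_def sgn_div_norm fun_eq_iff)
  then have deg: "degenerate_at q (0, 1)"
    using q(4)[OF K'(3)] by (simp add: degenerate_at_def)
  have "knot_equivalent K K'"
    unfolding knot_equivalent_def K'_def using h(1) by blast
  moreover have "Ck_embedding (enat n) S3 (graph_map q)"
    by (rule Ck_embedding_graph_map[OF q(1) S3_subset_annulus])
  moreover have "Ck_embedding \<infinity> (S3 - {(0, 1)}) (graph_map q)"
    by (rule Ck_embedding_graph_map[OF q(1)]) (use S3_subset_annulus in blast)
  moreover have "\<forall>(z, w)\<in>S3. graph_map q (z, w) = (z, w, q (z, w))"
    by (simp add: graph_map_def split_beta)
  ultimately show ?thesis
    using ct knot K'(3) deg by (intro exI[of _ "graph_map q"] conjI exI[of _ q] exI[of _ "(0, 1)"]) simp_all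
qed

end
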